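(* For every integer $r>1$ there exists a quasi-isometric embedding of the symmetric space $SL_{r+1}(\mathbb{R})/SO(r+1)$ into the symmetric space $Sp_{2r}(\mathbb{R})/U(r)$.
   Context: $Sp_{2r}(\mathbb{R})$ is the group of linear symplectic automorphisms of $\mathbb{R}^{2r}$ (real rank $r$), with maximal compact subgroup $U(r)$. Symmetric spaces carry their invariant Riemannian metrics. A map $f:X\to Y$ of metric spaces is a $(K,C)$-quasi-isometric embedding ($K\ge 1$, $C\ge 0$) if $\frac1K d_X(x_1,x_2)-C\le d_Y(f(x_1),f(x_2))\le K d_X(x_1,x_2)+C$ for all $x_1,x_2\in X$; it is a quasi-isometric embedding if this holds for some $K,C$. *)

theory Defs
  imports "HOL-Analysis.Analysis"
begin

section \<open>Homogeneous spaces of matrix groups with invariant Riemannian metrics\<close>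

definition left_coset :: "(real^'n^'n) set \<Rightarrow> real^'n^'n \<Rightarrow> (real^'n^'n) set" where
  "left_coset K g = (\<lambda>k. g ** k) ` K"

definition coset_space :: "(real^'n^'n) set \<Rightarrow> (real^'n^'n) set \<Rightarrow> (real^'n^'n) set set" where
  "coset_space G K = left_coset K ` G"

definition lie_algebra :: "(real^'n^'n) set \<Rightarrow> (real^'n^'n) set" where
  "lie_algebra G =
     {A. \<exists>\<gamma> :: real \<Rightarrow> real^'n^'n.
           \<gamma> 0 = mat 1 \<and> (\<forall>t. \<gamma> t \<in> G) \<and> (\<gamma> has_vector_derivative A) (at 0)}"

text \<open>
  A \<open>G\<close>-invariant Riemannian metric on \<open>G/K\<close> is determined by its inner product on the tangent
  space \<open>\<gg>/\<kk>\<close> at the base point, which can be any \<open>Ad(K)\<close>-invariant one. Such an inner product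
  is encoded by its pullback to \<open>\<gg>\<close>: an \<open>Ad(K)\<close>-invariant positive semidefinite
  symmetric bilinear form whose null space is exactly \<open>\<kk>\<close>. Only the restriction of \<open>Q\<close> to \<open>\<gg>\<close>
  matters; bilinearity on all matrices is no restriction, as every bilinear form on a
  subspace extends.
\<close>

definition invariant_riemannian_metric ::
    "(real^'n^'n) set \<Rightarrow> (real^'n^'n) set \<Rightarrow> (real^'n^'n \<Rightarrow> real^'n^'n \<Rightarrow> real) \<Rightarrow> bool" where
  "invariant_riemannian_metric G K Q \<longleftrightarrow>
     bilinear Q \<and>
     (\<forall>A\<in>lie_algebra G. \<forall>B\<in>lie_algebra G. Q A B = Q B A) \<and>
     (\<forall>A\<in>lie_algebra G. Q A A \<ge> 0) \<and>
     (\<forall>A\<in>lie_algebra G. Q A A = 0 \<longleftrightarrow> A \<in> lie_algebra K) \<and>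
     (\<forall>k\<in>K. \<forall>A\<in>lie_algebra G. \<forall>B\<in>lie_algebra G.
        Q (k ** A ** matrix_inv k) (k ** B ** matrix_inv k) = Q A B)"

text \<open>
  A piecewise \<open>C\<^sup>1\<close> curve in \<open>G/K\<close> is given by a piecewise \<open>C\<^sup>1\<close> lift \<open>\<gamma>\<close> to \<open>G\<close>; by left
  invariance its speed at time \<open>t\<close> is the \<open>Q\<close>-norm of \<open>\<gamma>(t)\<^sup>-\<^sup>1 \<gamma>'(t)\<close>, and this does not depend on
  the choice of the lift. The constant \<^const>\<open>valid_path\<close> allows the derivative to be unbounded near
  the finitely many break points. Requiring \<open>has_integral\<close>, rather than taking the value of
  \<open>integral\<close>, excludes curves of infinite length, to which \<open>integral\<close> would assign length \<open>0\<close>.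
\<close>

definition curve_speed ::
    "(real^'n^'n \<Rightarrow> real^'n^'n \<Rightarrow> real) \<Rightarrow> (real \<Rightarrow> real^'n^'n) \<Rightarrow> real \<Rightarrow> real" where
  "curve_speed Q \<gamma> t =
     (let A = matrix_inv (\<gamma> t) ** vector_derivative \<gamma> (at t within {0..1}) in sqrt (Q A A))"

definition riemannian_dist ::
    "(real^'n^'n) set \<Rightarrow> (real^'n^'n \<Rightarrow> real^'n^'n \<Rightarrow> real) \<Rightarrow>
     (real^'n^'n) set \<Rightarrow> (real^'n^'n) set \<Rightarrow> real" where
  "riemannian_dist G Q x y =
     Inf {L. \<exists>\<gamma>. valid_path \<gamma> \<and> path_image \<gamma> \<subseteq> G \<and> pathstart \<gamma> \<in> x \<and> pathfinish \<gamma> \<in> y \<and>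
               (curve_speed Q \<gamma> has_integral L) {0..1}}"

section \<open>The groups\<close>

definition SL :: "(real^'n^'n) set" where
  "SL = {g. det g = 1}"

definition SO :: "(real^'n^'n) set" where
  "SO = {g. rotation_matrix g}"

text \<open>
  \<open>\<real>\<^sup>2\<^sup>r\<close> is \<open>real^('n + 'n)\<close> with \<open>CARD('n) = r\<close>; the summands index the position and momentum
  coordinates of the standard symplectic form.
\<close>

definition symplectic_form :: "real^('n::finite + 'n) \<Rightarrow> real^('n + 'n) \<Rightarrow> real" where
  "symplectic_form x y = (\<Sum>i\<in>UNIV. x $ Inl i * y $ Inr i - x $ Inr i * y $ Inl i)"

definition Sp :: "(real^('n::finite + 'n)^('n + 'n)) set" where
  "Sp = {g. invertible g \<and> (\<forall>x y. symplectic_form (g *v x) (g *v y) = symplectic_form x y)}"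

definition unitary_matrix :: "complex^'n^'n \<Rightarrow> bool" where
  "unitary_matrix u \<longleftrightarrow>
     (\<chi> i j. cnj (u $ j $ i)) ** u = mat 1 \<and> u ** (\<chi> i j. cnj (u $ j $ i)) = mat 1"

text \<open>
  The real matrix of a complex linear map under \<open>\<complex>\<^sup>r = \<real>\<^sup>2\<^sup>r\<close>, \<open>x + \<i> y = (x, y)\<close>, that is the
  block matrix with rows \<open>(Re u, - Im u)\<close> and \<open>(Im u, Re u)\<close>.
\<close>

definition realification :: "complex^'n^'n \<Rightarrow> real^('n::finite + 'n)^('n + 'n)" where
  "realification u =
     (\<chi> p q. case p of
        Inl i \<Rightarrow> (case q of Inl j \<Rightarrow> Re (u $ i $ j) | Inr j \<Rightarrow> - Im (u $ i $ j))
      | Inr i \<Rightarrow> (case q of Inl j \<Rightarrow> Im (u $ i $ j) | Inr j \<Rightarrow> Re (u $ i $ j)))"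

definition U :: "(real^('n::finite + 'n)^('n + 'n)) set" where
  "U = realification ` {u. unitary_matrix u}"

section \<open>Quasi-isometric embeddings\<close>

definition KC_quasi_isometric_embedding ::
    "real \<Rightarrow> real \<Rightarrow> 'a set \<Rightarrow> ('a \<Rightarrow> 'a \<Rightarrow> real) \<Rightarrow> 'b set \<Rightarrow> ('b \<Rightarrow> 'b \<Rightarrow> real) \<Rightarrow> ('a \<Rightarrow> 'b) \<Rightarrow> bool" where
  "KC_quasi_isometric_embedding K C X dX Y dY f \<longleftrightarrow>
     f ` X \<subseteq> Y \<and>
     (\<forall>x1\<in>X. \<forall>x2\<in>X.
        1 / K * dX x1 x2 - C \<le> dY (f x1) (f x2) \<and> dY (f x1) (f x2) \<le> K * dX x1 x2 + C)"

definition quasi_isometric_embedding ::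
    "'a set \<Rightarrow> ('a \<Rightarrow> 'a \<Rightarrow> real) \<Rightarrow> 'b set \<Rightarrow> ('b \<Rightarrow> 'b \<Rightarrow> real) \<Rightarrow> ('a \<Rightarrow> 'b) \<Rightarrow> bool" where
  "quasi_isometric_embedding X dX Y dY f \<longleftrightarrow>
     (\<exists>K C. K \<ge> 1 \<and> C \<ge> 0 \<and> KC_quasi_isometric_embedding K C X dX Y dY f)"

end

theory Submission
  imports Defs
begin

text \<open>
  In both symmetric spaces the distance from \<open>K\<close> to \<open>g K\<close> is at least a multiple of \<open>ln \<parallel>g\<parallel>\<close>, up to
  an additive constant, because the logarithm of the Frobenius norm is Lipschitz along curves. By
  the Iwasawa decomposition every coset of \<open>SO\<close> has a representative in the group of upper triangular
  matrices with positive diagonal and determinant \<open>1\<close>. This group embeds homomorphically into \<open>Sp\<close>: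
  with \<open>b'\<close>, \<open>v\<close>, \<open>d\<close> the upper left, upper right and lower right blocks of \<open>b\<close>, the image of \<open>b\<close> has
  diagonal blocks \<open>B = \<lambda> b'\<close> and \<open>D = B\<^sup>-\<^sup>T\<close> and upper right block \<open>S D\<close>, where \<open>S = e w\<^sup>T + w e\<^sup>T\<close>,
  \<open>w = v / d\<close>, \<open>e\<close> is the first basis vector and \<open>\<lambda>\<^sup>2 = 1 / (d b\<^sub>1\<^sub>1)\<close>. The homomorphism distorts norms
  at most polynomially. Finally, a triangular matrix \<open>b\<close> is joined to the identity inside the
  triangular group by a curve of length \<open>O (1 + ln \<parallel>b\<parallel>)\<close>, so that all the distances involved are
  comparable with \<open>ln \<parallel>b\<parallel>\<close>.
\<close>

section \<open>Real matrices\<close>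

text \<open>Write x_1, ..., x_(r+1) for the diagonal weights of SL and \<epsilon>_1, ...,
  \<epsilon>_r for those of Sp. Putting \<epsilon>_i = x_i - (x_1 + x_(r+1)) / 2 turns the roots x_i
  - x_j with j \<le> r into \<epsilon>_i - \<epsilon>_j and the roots x_i - x_(r+1) into
  \<epsilon>_i + \<epsilon>_1. This is the origin of both \<lambda> and S. The construction rests on
  e being an eigenvector of b', which triangularity provides, so the embedding lives on the
  triangular group alone. That shapes the proof: the short curves must stay triangular, so that one
  curve and its image bound the distances from above in both spaces. Translating by b reduces a pair
  b, c to the single element b^(-1) c, and multiplicativity does the same for the images. Since
  everything is measured by ln of a norm, polynomial losses in norms become linear losses in
  distance, which a quasi-isometric embedding tolerates.\<close>

lemma matrix_inv_left:
  fixes A :: "real^'n^'n"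
  assumes "invertible A"
  shows "matrix_inv A ** A = mat 1"
  using someI_ex[OF assms[unfolded invertible_def]] unfolding matrix_inv_def by blast

lemma matrix_inv_right:
  fixes A :: "real^'n^'n"
  assumes "invertible A"
  shows "A ** matrix_inv A = mat 1"
  using someI_ex[OF assms[unfolded invertible_def]] unfolding matrix_inv_def by blast

lemma matrix_inv_unique:
  fixes A B :: "real^'n^'n"
  assumes "A ** B = mat 1"
  shows "matrix_inv A = B"
proof -
  have "invertible A" using assms invertible_right_inverse by blast
  then have "matrix_inv A ** (A ** B) = B"
    by (simp add: matrix_mul_assoc matrix_inv_left)
  then show ?thesis by (simp add: assms)
qed

lemma matrix_inv_mat_1 [simp]: "matrix_inv (mat 1 :: real^'n^'n) = mat 1"
  by (rule matrix_inv_unique) simp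

lemma matrix_inv_mult:
  fixes A B :: "real^'n^'n"
  assumes "invertible A" "invertible B"
  shows "matrix_inv (A ** B) = matrix_inv B ** matrix_inv A"
proof (rule matrix_inv_unique)
  have "A ** B ** (matrix_inv B ** matrix_inv A) = A ** (B ** matrix_inv B) ** matrix_inv A"
    by (simp add: matrix_mul_assoc)
  then show "A ** B ** (matrix_inv B ** matrix_inv A) = mat 1"
    by (simp add: matrix_inv_right assms)
qed

lemma invertible_matrix_inv:
  fixes A :: "real^'n^'n"
  shows "invertible A \<Longrightarrow> invertible (matrix_inv A)"
  using invertible_def matrix_inv_left matrix_inv_right by blast

lemma matrix_inv_matrix_inv:
  fixes A :: "real^'n^'n"
  shows "invertible A \<Longrightarrow> matrix_inv (matrix_inv A) = A"
  by (simp add: matrix_inv_left matrix_inv_unique)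

lemma det_matrix_inv:
  fixes A :: "real^'n^'n"
  assumes "invertible A"
  shows "det (matrix_inv A) = inverse (det A)"
  using det_mul[of A "matrix_inv A"] matrix_inv_right[OF assms]
  by (metis det_I inverse_unique)

section \<open>Bilinearity of the matrix product and the Frobenius norm\<close>

lemma bounded_bilinear_matrix_mult:
  "bounded_bilinear (\<lambda>(A :: real^'n^'m) (B :: real^'k^'n). A ** B)"
proof -
  have "bilinear (\<lambda>(A :: real^'n^'m) (B :: real^'k^'n). A ** B)"
    unfolding bilinear_def
    by (auto intro!: linearI simp: matrix_add_ldistrib matrix_scalar_ac scalar_matrix_assoc
        vec_eq_iff matrix_matrix_mult_def sum.distrib sum_distrib_left algebra_simps)
  then show ?thesis by (simp add: bilinear_conv_bounded_bilinear)
qed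

lemmas has_vector_derivative_matrix_mult =
  bounded_bilinear.has_vector_derivative[OF bounded_bilinear_matrix_mult]

lemmas continuous_on_matrix_mult =
  bounded_bilinear.continuous_on[OF bounded_bilinear_matrix_mult]

lemma matrix_mult_zero_left [simp]: "0 ** A = (0 :: real^'k^'m)"
  by (rule bounded_bilinear.zero_left[OF bounded_bilinear_matrix_mult])

lemma matrix_mult_zero_right [simp]: "A ** 0 = (0 :: real^'k^'m)"
  by (rule bounded_bilinear.zero_right[OF bounded_bilinear_matrix_mult])

lemmas matrix_mult_linear_simps =
  bounded_bilinear.add_left[OF bounded_bilinear_matrix_mult]
  bounded_bilinear.add_right[OF bounded_bilinear_matrix_mult]
  bounded_bilinear.diff_left[OF bounded_bilinear_matrix_mult]
  bounded_bilinear.diff_right[OF bounded_bilinear_matrix_mult]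
  bounded_bilinear.minus_left[OF bounded_bilinear_matrix_mult]
  bounded_bilinear.minus_right[OF bounded_bilinear_matrix_mult]
  bounded_bilinear.scaleR_left[OF bounded_bilinear_matrix_mult]
  bounded_bilinear.scaleR_right[OF bounded_bilinear_matrix_mult]

lemma norm_matrix_power2: "(norm (A :: real^'n^'m))\<^sup>2 = (\<Sum>i\<in>UNIV. \<Sum>j\<in>UNIV. (A$i$j)\<^sup>2)"
  unfolding power2_norm_eq_inner by (simp add: inner_vec_def power2_eq_square)

lemma norm_matrix_mult_le:
  fixes A :: "real^'n^'m" and B :: "real^'k^'n"
  shows "norm (A ** B) \<le> norm A * norm B"
proof (rule power2_le_imp_le)
  have "(norm (A ** B))\<^sup>2 = (\<Sum>i\<in>UNIV. \<Sum>j\<in>UNIV. (\<Sum>k\<in>UNIV. A$i$k * B$k$j)\<^sup>2)"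
    by (simp add: norm_matrix_power2 matrix_matrix_mult_def)
  also have "\<dots> \<le> (\<Sum>i\<in>UNIV. \<Sum>j\<in>UNIV. (\<Sum>k\<in>UNIV. (A$i$k)\<^sup>2) * (\<Sum>k\<in>UNIV. (B$k$j)\<^sup>2))"
    by (intro sum_mono Cauchy_Schwarz_ineq_sum)
  also have "\<dots> = (\<Sum>i\<in>UNIV. \<Sum>k\<in>UNIV. (A$i$k)\<^sup>2) * (\<Sum>j\<in>UNIV. \<Sum>k\<in>UNIV. (B$k$j)\<^sup>2)"
    by (simp add: sum_product)
  also have "\<dots> = (norm A * norm B)\<^sup>2"
    by (subst sum.swap[of _ UNIV UNIV, where g="\<lambda>j k. (B$k$j)\<^sup>2"])
      (simp add: norm_matrix_power2 power_mult_distrib)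
  finally show "(norm (A ** B))\<^sup>2 \<le> (norm A * norm B)\<^sup>2" .
qed simp

lemma abs_entry_le_norm: "\<bar>(A :: real^'n^'m)$i$j\<bar> \<le> norm A"
  using component_le_norm_cart[of "A$i" j] Finite_Cartesian_Product.norm_nth_le[of A i] by linarith

lemma norm_matrix_le_sum: "norm (A :: real^'n^'m) \<le> (\<Sum>i\<in>UNIV. \<Sum>j\<in>UNIV. \<bar>A$i$j\<bar>)"
proof -
  have "norm A \<le> (\<Sum>i\<in>UNIV. norm (A$i))"
    unfolding norm_vec_def by (rule L2_set_le_sum) simp
  also have "\<dots> \<le> (\<Sum>i\<in>UNIV. \<Sum>j\<in>UNIV. \<bar>A$i$j\<bar>)"
    by (rule sum_mono) (rule norm_le_l1_cart)
  finally show ?thesis .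
qed

lemma norm_matrix_le_const:
  fixes M :: real
  assumes "\<And>i j. \<bar>(A :: real^'n^'m)$i$j\<bar> \<le> M"
  shows "norm A \<le> CARD('m) * CARD('n) * M"
proof -
  have "norm A \<le> (\<Sum>i\<in>(UNIV :: 'm set). \<Sum>j\<in>(UNIV :: 'n set). M)"
    using norm_matrix_le_sum[of A] by (rule order_trans) (intro sum_mono assms)
  then show ?thesis by (simp add: mult.assoc)
qed

text \<open>Both sides pair the symmetric matrix \<open>transpose M ** M\<close> with
  \<open>A\<close> or its transpose. Hence only the symmetric part of \<open>A\<close> affects the
  norm of \<open>M\<close> to first order.\<close>

lemma inner_matrix_mult_transpose:
  fixes M A :: "real^'n^'n"
  shows "M \<bullet> (M ** A) = M \<bullet> (M ** transpose A)"
proof -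
  have "M \<bullet> (M ** A) = (\<Sum>i\<in>UNIV. \<Sum>j\<in>UNIV. \<Sum>k\<in>UNIV. M$i$j * (M$i$k * A$k$j))"
    by (simp add: inner_vec_def matrix_matrix_mult_def sum_distrib_left)
  also have "\<dots> = (\<Sum>i\<in>UNIV. \<Sum>k\<in>UNIV. \<Sum>j\<in>UNIV. M$i$j * (M$i$k * A$k$j))"
    by (rule sum.cong[OF refl]) (rule sum.swap)
  also have "\<dots> = M \<bullet> (M ** transpose A)"
    by (simp add: inner_vec_def matrix_matrix_mult_def sum_distrib_left transpose_def algebra_simps)
  finally show ?thesis .
qed

lemma transpose_add: "transpose (A + B) = transpose A + transpose (B :: 'a::semiring_1^'n^'m)"
  by (simp add: transpose_def vec_eq_iff)

lemma transpose_diff: "transpose (A - B) = transpose A - transpose (B :: 'a::ring_1^'n^'m)"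
  by (simp add: transpose_def vec_eq_iff)

lemma bounded_linear_transpose: "bounded_linear (transpose :: real^'n^'m \<Rightarrow> real^'m^'n)"
  by (auto intro!: linearI simp: linear_conv_bounded_linear[symmetric] transpose_add transpose_scalar)

lemma norm_mult_orthogonal_right:
  fixes A k :: "real^'n^'n"
  assumes "orthogonal_matrix k"
  shows "norm (A ** k) = norm A"
proof -
  have *: "k ** transpose k = mat 1" "transpose k ** k = mat 1"
    using assms by (auto simp: orthogonal_matrix_def)
  have "(A ** k) \<bullet> (A ** k) = A \<bullet> A"
    unfolding inner_vec_def[of "A ** k"] inner_vec_def[of A]
  proof (rule sum.cong[OF refl])
    fix i
    have row: "(A ** k)$i = transpose k *v A$i" for i
      by (simp add: matrix_matrix_mult_def vector_matrix_mult_def vec_eq_iff mult.commute)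
    show "(A ** k)$i \<bullet> (A ** k)$i = A$i \<bullet> A$i"
      unfolding row
      by (metis * dot_lmul_matrix transpose_matrix_vector matrix_vector_mul_assoc matrix_vector_mul_lid)
  qed
  then show ?thesis by (simp add: norm_eq_sqrt_inner)
qed

lemma norm_transpose: "norm (transpose (A :: real^'n^'m)) = norm A"
proof -
  have "(norm (transpose A))\<^sup>2 = (norm A)\<^sup>2"
    unfolding norm_matrix_power2 transpose_def by simp (rule sum.swap)
  then show ?thesis by simp
qed

lemma norm_mult_orthogonal_left:
  fixes A k :: "real^'n^'n"
  assumes "orthogonal_matrix k"
  shows "norm (k ** A) = norm A"
  using norm_mult_orthogonal_right[of "transpose k" "transpose A"] assms
  by (metis matrix_transpose_mul norm_transpose orthogonal_matrix_transpose)

text \<open>Cramer's rule: for determinant 1 the entries of the inverse are polynomials in those of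
  \<open>A\<close>, which yields both the bound and the continuity below.\<close>

lemma matrix_inv_entry_det:
  fixes A :: "real^'n^'n"
  assumes "det A = 1"
  shows "matrix_inv A $ k $ j = det (\<chi> i j'. if j' = k then axis j 1 $ i else A $ i $ j')"
proof -
  have inv: "invertible A" using assms by (simp add: invertible_det_nz)
  have "A *v (matrix_inv A *v axis j 1) = axis j 1"
    by (simp add: matrix_vector_mul_assoc matrix_inv_right inv)
  then have "matrix_inv A *v axis j 1 =
      (\<chi> k. det (\<chi> i j'. if j' = k then axis j 1 $ i else A $ i $ j') / det A)"
    using cramer[of A _ "axis j 1"] assms by simp
  then have "(matrix_inv A *v axis j 1) $ k = det (\<chi> i j'. if j' = k then axis j 1 $ i else A $ i $ j')"
    by (simp add: assms)
  moreover have "(matrix_inv A *v axis j 1) $ k = matrix_inv A $ k $ j"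
    by (simp add: matrix_vector_mult_def axis_def if_distrib cong: if_cong)
  ultimately show ?thesis by simp
qed

text \<open>Leibniz expansion: \<open>fact CARD('n)\<close> permutations, each giving a product of
  \<open>CARD('n)\<close> factors of size at most \<open>M\<close>; \<open>1 \<le> M\<close> also
  covers the entries 0 and 1 of the replaced column.\<close>

lemma inverse_entry_bound:
  fixes A :: "real^'n^'n"
  assumes "det A = 1" "\<And>i j. \<bar>A$i$j\<bar> \<le> M" "1 \<le> M"
  shows "\<bar>matrix_inv A $ k $ j\<bar> \<le> fact CARD('n) * M ^ CARD('n)"
proof -
  define D :: "real^'n^'n" where "D = (\<chi> i j'. if j' = k then axis j 1 $ i else A$i$j')"
  have "\<bar>det D\<bar> \<le> fact CARD('n) * M ^ CARD('n)"
  proof -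
    have "\<bar>det D\<bar> \<le> (\<Sum>p\<in>{p. p permutes (UNIV :: 'n set)}. \<bar>of_int (sign p) * (\<Prod>i\<in>UNIV. D$i$p i)\<bar>)"
      unfolding det_def by (rule sum_abs)
    also have "\<dots> \<le> (\<Sum>p\<in>{p. p permutes (UNIV :: 'n set)}. M ^ CARD('n))"
    proof (rule sum_mono)
      fix p
      have "\<bar>of_int (sign p) * (\<Prod>i\<in>UNIV. D$i$p i)\<bar> = (\<Prod>i\<in>UNIV. \<bar>D$i$p i\<bar>)"
        by (simp add: abs_mult abs_prod sign_def)
      also have "\<dots> \<le> (\<Prod>i\<in>(UNIV :: 'n set). M)"
        using assms(2,3) by (intro prod_mono) (auto simp: D_def axis_def intro: order_trans)
      finally show "\<bar>of_int (sign p) * (\<Prod>i\<in>UNIV. D$i$p i)\<bar> \<le> M ^ CARD('n)" by simp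
    qed
    also have "\<dots> = fact CARD('n) * M ^ CARD('n)"
      by (simp add: card_permutations)
    finally show ?thesis .
  qed
  then show ?thesis by (simp add: matrix_inv_entry_det[OF assms(1)] D_def)
qed

lemma continuous_on_matrix_inv:
  fixes \<gamma> :: "real \<Rightarrow> real^'n^'n"
  assumes "continuous_on S \<gamma>" "\<And>t. t \<in> S \<Longrightarrow> det (\<gamma> t) = 1"
  shows "continuous_on S (\<lambda>t. matrix_inv (\<gamma> t))"
proof -
  have entry: "continuous_on S (\<lambda>t. if P then c else \<gamma> t $ i $ j)" for P c i j
    by (cases P) (auto intro!: continuous_intros assms(1))
  have "continuous_on S (\<lambda>t. \<chi> k j. det (\<chi> i j'. if j' = k then axis j 1 $ i else \<gamma> t $ i $ j'))"
    unfolding det_def vec_lambda_beta by (intro continuous_intros entry)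
  then show ?thesis
    by (rule continuous_on_eq) (simp add: vec_eq_iff matrix_inv_entry_det[OF assms(2)])
qed

section \<open>Differentiation of matrix-valued curves\<close>

lemma has_vector_derivative_matrix_entries:
  fixes f :: "real \<Rightarrow> real^'n^'m"
  assumes "\<And>i j. ((\<lambda>t. f t $ i $ j) has_vector_derivative D $ i $ j) (at x within S)"
  shows "(f has_vector_derivative D) (at x within S)"
  unfolding has_vector_derivative_def
proof (subst has_derivative_componentwise_within, rule ballI)
  fix u :: "real^'n^'m" assume "u \<in> Basis"
  then have "u \<in> (\<Union>i. \<Union>v\<in>Basis. {axis i v})" by (subst (asm) Basis_vec_def)
  then obtain i v where v: "v \<in> Basis" "u \<in> {axis i v}" by (elim UN_E)
  obtain j where "v = axis j 1" using axis_inverse[OF v(1)] by (elim exE)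
  with v have u: "u = axis i (axis j 1)" by simp
  show "((\<lambda>t. f t \<bullet> u) has_derivative (\<lambda>t. (t *\<^sub>R D) \<bullet> u)) (at x within S)"
    unfolding u inner_axis scaleR_vec_def vec_lambda_beta inner_real_def mult_1_right
    by (rule assms[of i j, unfolded has_vector_derivative_def])
qed

lemma has_vector_derivative_entry:
  fixes f :: "real \<Rightarrow> real^'n^'m"
  assumes "(f has_vector_derivative D) (at x within S)"
  shows "((\<lambda>t. f t $ i $ j) has_real_derivative D $ i $ j) (at x within S)"
  unfolding has_real_derivative_iff_has_vector_derivative
  by (intro bounded_linear.has_vector_derivative[OF bounded_linear_vec_nth] assms)

lemma has_vector_derivative_matrix_inv:
  fixes \<gamma> :: "real \<Rightarrow> real^'n^'n"
  assumes d: "(\<gamma> has_vector_derivative \<gamma> t ** A) (at t within S)" and t: "t \<in> S"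
    and cont: "continuous_on S \<gamma>" and det: "\<And>s. s \<in> S \<Longrightarrow> det (\<gamma> s) = 1"
  shows "((\<lambda>s. matrix_inv (\<gamma> s)) has_vector_derivative - (A ** matrix_inv (\<gamma> t))) (at t within S)"
  unfolding has_vector_derivative_def
proof (rule has_derivativeI_sandwich[of 1])
  define f where "f s = matrix_inv (\<gamma> s)" for s
  define r where "r s = \<gamma> s - \<gamma> t - (s - t) *\<^sub>R (\<gamma> t ** A)" for s
  define H where "H s = norm (mat 1 - f s ** \<gamma> t) * norm (A ** f t) + norm (f s) * (norm (r s) / norm (s - t)) * norm (f t)" for s
  have inv: "f s ** \<gamma> s = mat 1" "\<gamma> s ** f s = mat 1" if "s \<in> S" for s
    using det[OF that] by (simp_all add: f_def matrix_inv_left matrix_inv_right invertible_det_nz)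
  show "bounded_linear (\<lambda>x. x *\<^sub>R - (A ** matrix_inv (\<gamma> t)))" by (rule bounded_linear_scaleR_left)
  have "((\<lambda>s. norm (r s) / norm (s - t)) \<longlongrightarrow> 0) (at t within S)"
    using d unfolding has_vector_derivative_def has_derivative_iff_norm r_def by blast
  moreover have f_lim: "(f \<longlongrightarrow> f t) (at t within S)"
    using continuous_on_matrix_inv[OF cont det] t unfolding f_def[abs_def] by (simp add: continuous_on_def)
  moreover have "((\<lambda>s. f s ** \<gamma> t) \<longlongrightarrow> f t ** \<gamma> t) (at t within S)"
    by (rule bounded_bilinear.tendsto[OF bounded_bilinear_matrix_mult f_lim tendsto_const])
  ultimately have "(H \<longlongrightarrow> norm (mat 1 - f t ** \<gamma> t) * norm (A ** f t) + norm (f t) * 0 * norm (f t)) (at t within S)"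
    unfolding H_def by (intro tendsto_intros)
  then show "(H \<longlongrightarrow> 0) (at t within S)" by (simp add: inv[OF t])
  fix s assume s: "s \<in> S" "s \<noteq> t"
  \<comment> \<open>The resolvent identity; inserting the first-order expansion of
    \<open>\<gamma> s\<close> leaves an error that \<open>H\<close> controls.\<close>
  have "f s - f t = - (f s ** (\<gamma> s - \<gamma> t) ** f t)"
  proof -
    have "f s ** (\<gamma> s - \<gamma> t) ** f t = (f s ** \<gamma> s) ** f t - f s ** (\<gamma> t ** f t)"
      by (simp add: matrix_mult_linear_simps matrix_mul_assoc)
    then show ?thesis by (simp add: inv s t)
  qed
  also have "\<gamma> s - \<gamma> t = (s - t) *\<^sub>R (\<gamma> t ** A) + r s" by (simp add: r_def)
  finally have "f s - f t - (s - t) *\<^sub>R - (A ** f t) =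
      (s - t) *\<^sub>R ((mat 1 - f s ** \<gamma> t) ** (A ** f t)) - f s ** r s ** f t"
    by (simp add: matrix_mult_linear_simps matrix_mul_assoc scaleR_diff_right)
  then have "norm (f s - f t - (s - t) *\<^sub>R - (A ** f t)) \<le>
      norm ((s - t) *\<^sub>R ((mat 1 - f s ** \<gamma> t) ** (A ** f t))) + norm (f s ** r s ** f t)"
    by (simp only: norm_triangle_ineq4)
  also have "\<dots> \<le> \<bar>s - t\<bar> * (norm (mat 1 - f s ** \<gamma> t) * norm (A ** f t)) + norm (f s) * norm (r s) * norm (f t)"
    unfolding norm_scaleR
    by (intro add_mono mult_left_mono norm_matrix_mult_le abs_ge_zero
        order_trans[OF norm_matrix_mult_le mult_right_mono[OF norm_matrix_mult_le]] norm_ge_zero)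
  also have "\<dots> = H s * norm (s - t)"
    using s(2) by (simp add: H_def field_simps)
  finally show "norm (matrix_inv (\<gamma> s) - matrix_inv (\<gamma> t) - (s - t) *\<^sub>R - (A ** matrix_inv (\<gamma> t))) / norm (s - t) \<le> H s"
    using s(2) by (simp add: f_def divide_le_eq)
qed simp

definition diag_matrix :: "('n \<Rightarrow> real) \<Rightarrow> real^'n^'n" where
  "diag_matrix d = (\<chi> i j. if i = j then d j else 0)"

lemma matrix_mult_diag_nth: "((A :: real^'n^'m) ** diag_matrix d) $ i $ j = A $ i $ j * d j"
  by (simp add: matrix_matrix_mult_def diag_matrix_def if_distrib cong: if_cong)

lemma diag_mult_matrix_nth: "(diag_matrix d ** (A :: real^'n^'m)) $ i $ j = d i * A $ i $ j"
  by (simp add: matrix_matrix_mult_def diag_matrix_def if_distrib[of "\<lambda>c. c * _"] cong: if_cong)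

section \<open>Distances in homogeneous spaces of self-adjoint matrix groups\<close>

text \<open>The set whose infimum is \<open>riemannian_dist\<close>, named so that its being
  nonempty can be tracked: the infimum of an empty set of reals carries no information.\<close>

definition curve_lengths ::
    "(real^'n^'n) set \<Rightarrow> (real^'n^'n \<Rightarrow> real^'n^'n \<Rightarrow> real) \<Rightarrow>
     (real^'n^'n) set \<Rightarrow> (real^'n^'n) set \<Rightarrow> real set" where
  "curve_lengths G Q x y =
     {L. \<exists>\<gamma>. valid_path \<gamma> \<and> path_image \<gamma> \<subseteq> G \<and> pathstart \<gamma> \<in> x \<and> pathfinish \<gamma> \<in> y \<and>
             (curve_speed Q \<gamma> has_integral L) {0..1}}"

lemma lie_algebraI:
  assumes "\<gamma> 0 = mat 1" "\<And>t. \<gamma> t \<in> G" "(\<gamma> has_vector_derivative A) (at 0)"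
  shows "A \<in> lie_algebra G"
  using assms unfolding lie_algebra_def by blast

text \<open>The common features of SL/SO and Sp/U. Closure under transposes splits the Lie algebra
  into symmetric and skew parts, and \<open>skew_in_lie_K\<close> puts the skew part into the Lie
  algebra of \<open>K\<close>, so only the symmetric part is seen by the metric.\<close>

locale self_adjoint_group_pair =
  fixes G K :: "(real^'n^'n) set"
  assumes one_in_G: "mat 1 \<in> G"
    and mult_in_G: "g \<in> G \<Longrightarrow> h \<in> G \<Longrightarrow> g ** h \<in> G"
    and invertible_G: "g \<in> G \<Longrightarrow> invertible g"
    and inv_in_G: "g \<in> G \<Longrightarrow> matrix_inv g \<in> G"
    and transpose_in_G: "g \<in> G \<Longrightarrow> transpose g \<in> G"
    and one_in_K: "mat 1 \<in> K"
    and orthogonal_K: "k \<in> K \<Longrightarrow> orthogonal_matrix k"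
    and skew_in_lie_K: "A \<in> lie_algebra G \<Longrightarrow> transpose A = - A \<Longrightarrow> A \<in> lie_algebra K"
begin

section \<open>The Lie algebra of a self-adjoint group\<close>

lemma subspace_lie_G: "subspace (lie_algebra G)"
  unfolding subspace_def
proof (intro conjI ballI allI)
  show "0 \<in> lie_algebra G"
    by (rule lie_algebraI[of "\<lambda>_. mat 1"]) (auto simp: one_in_G)
next
  fix A B assume "A \<in> lie_algebra G" "B \<in> lie_algebra G"
  then obtain \<alpha> \<beta> where *: "\<alpha> 0 = mat 1" "\<And>t. \<alpha> t \<in> G" "(\<alpha> has_vector_derivative A) (at 0)"
      "\<beta> 0 = mat 1" "\<And>t. \<beta> t \<in> G" "(\<beta> has_vector_derivative B) (at 0)"
    unfolding lie_algebra_def by blast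
  show "A + B \<in> lie_algebra G"
    using has_vector_derivative_matrix_mult[OF *(3,6)]
    by (intro lie_algebraI[of "\<lambda>t. \<alpha> t ** \<beta> t"]) (auto simp: * mult_in_G add.commute)
next
  fix A :: "real^'n^'n" and c :: real assume "A \<in> lie_algebra G"
  then obtain \<alpha> where *: "\<alpha> 0 = mat 1" "\<And>t. \<alpha> t \<in> G" "(\<alpha> has_vector_derivative A) (at 0)"
    unfolding lie_algebra_def by blast
  have "((\<lambda>t. c * t) has_vector_derivative c) (at 0)"
    by (auto intro!: derivative_eq_intros)
  from vector_diff_chain_at[OF this, of \<alpha> A] *(3)
  show "c *\<^sub>R A \<in> lie_algebra G"
    by (intro lie_algebraI[of "\<lambda>t. \<alpha> (c * t)"]) (auto simp: * o_def)
qed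

lemma transpose_in_lie_G:
  assumes "A \<in> lie_algebra G"
  shows "transpose A \<in> lie_algebra G"
proof -
  obtain \<alpha> where *: "\<alpha> 0 = mat 1" "\<And>t. \<alpha> t \<in> G" "(\<alpha> has_vector_derivative A) (at 0)"
    using assms unfolding lie_algebra_def by blast
  show ?thesis
    using bounded_linear.has_vector_derivative[OF bounded_linear_transpose *(3)]
    by (intro lie_algebraI[of "\<lambda>t. transpose (\<alpha> t)"]) (auto simp: * transpose_in_G)
qed

lemma lie_K_skew:
  assumes "A \<in> lie_algebra K"
  shows "transpose A = - A"
proof -
  obtain \<alpha> where *: "\<alpha> 0 = mat 1" "\<And>t. \<alpha> t \<in> K" "(\<alpha> has_vector_derivative A) (at 0)"
    using assms unfolding lie_algebra_def by blast
  have "((\<lambda>t. transpose (\<alpha> t) ** \<alpha> t) has_vector_derivative A + transpose A) (at 0)"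
    using has_vector_derivative_matrix_mult[OF
        bounded_linear.has_vector_derivative[OF bounded_linear_transpose *(3)] *(3)]
    by (simp add: *)
  moreover have "(\<lambda>t. transpose (\<alpha> t) ** \<alpha> t) = (\<lambda>t. mat 1)"
    using orthogonal_K[OF *(2)] by (simp add: orthogonal_matrix)
  ultimately have "((\<lambda>t. mat 1 :: real^'n^'n) has_vector_derivative A + transpose A) (at (0::real))"
    by simp
  from vector_derivative_unique_at[OF this has_vector_derivative_const]
  show ?thesis by (simp add: eq_neg_iff_add_eq_0 add.commute)
qed

lemma left_logarithmic_derivative_in_lie_G:
  fixes \<gamma> :: "real \<Rightarrow> real^'n^'n"
  assumes "(\<gamma> has_vector_derivative D) (at t)" "0 < t" "t < 1" "\<And>s. s \<in> {0..1} \<Longrightarrow> \<gamma> s \<in> G"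
  shows "matrix_inv (\<gamma> t) ** D \<in> lie_algebra G"
proof -
  \<comment> \<open>\<open>lie_algebra\<close> asks for a curve on all of the reals, so the
    translated curve is continued by \<open>mat 1\<close> outside the parameter interval; only its
    germ at 0 matters.\<close>
  define \<eta> where "\<eta> s = (if t + s \<in> {0..1} then matrix_inv (\<gamma> t) ** \<gamma> (t + s) else mat 1)" for s
  have gt: "\<gamma> t \<in> G" using assms by simp
  have "((\<lambda>s. t + s) has_vector_derivative 1) (at 0)"
    by (auto intro!: derivative_eq_intros)
  from vector_diff_chain_at[OF this, of \<gamma> D] assms(1)
  have "((\<lambda>s. \<gamma> (t + s)) has_vector_derivative D) (at 0)"
    by (simp add: o_def)
  from has_vector_derivative_matrix_mult[OF has_vector_derivative_const[of "matrix_inv (\<gamma> t)"] this]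
  have "((\<lambda>s. matrix_inv (\<gamma> t) ** \<gamma> (t + s)) has_vector_derivative matrix_inv (\<gamma> t) ** D) (at 0)"
    by (simp add: bounded_bilinear.zero_left[OF bounded_bilinear_matrix_mult])
  then have "(\<eta> has_vector_derivative matrix_inv (\<gamma> t) ** D) (at 0)"
    by (rule has_vector_derivative_transform_within_open[of _ _ _ "{-t<..<1-t}"])
      (use assms(2,3) in \<open>auto simp: \<eta>_def\<close>)
  moreover have "\<eta> 0 = mat 1"
    using assms(2,3) by (simp add: \<eta>_def matrix_inv_left invertible_G gt)
  moreover have "\<eta> s \<in> G" for s
    using assms(4) by (auto simp: \<eta>_def intro!: mult_in_G inv_in_G gt one_in_G)
  ultimately show ?thesis by (intro lie_algebraI[of \<eta>])
qed

text \<open>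
  The quadratic form only sees the symmetric part, because the skew part lies in its null space;
  on symmetric matrices it is bounded below by compactness of the unit sphere.
\<close>

lemma metric_coercive:
  assumes "invariant_riemannian_metric G K Q"
  obtains c where "c > 0"
    "\<And>A. A \<in> lie_algebra G \<Longrightarrow> c * norm (A + transpose A) \<le> sqrt (Q A A)"
    "\<And>A. A \<in> lie_algebra G \<Longrightarrow> 0 \<le> Q A A"
proof -
  let ?g = "lie_algebra G"
  have bil: "bilinear Q" and sym: "\<And>A B. A \<in> ?g \<Longrightarrow> B \<in> ?g \<Longrightarrow> Q A B = Q B A"
    and psd: "\<And>A. A \<in> ?g \<Longrightarrow> 0 \<le> Q A A"
    and null: "\<And>A. A \<in> ?g \<Longrightarrow> Q A A = 0 \<longleftrightarrow> A \<in> lie_algebra K"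
    using assms unfolding invariant_riemannian_metric_def by auto
  note sub = subspace_add[OF subspace_lie_G] subspace_scale[OF subspace_lie_G]
    subspace_diff[OF subspace_lie_G]
  note Q = bilinear_ladd[OF bil] bilinear_radd[OF bil] bilinear_lmul[OF bil] bilinear_rmul[OF bil]
  \<comment> \<open>A null vector of a semidefinite form pairs to zero with everything, since
    otherwise the form would be negative at some N + t S. The denominator s + 1 in \<open>t\<close>
    avoids a case split at s = 0.\<close>
  have cross: "Q S N = 0" if "S \<in> ?g" "N \<in> ?g" "Q N N = 0" for S N
  proof -
    define q s where "q = Q N S" and "s = Q S S"
    define t where "t = - q / (s + 1)"
    have s0: "s \<ge> 0" using psd that by (simp add: s_def)
    have qt: "q = - (t * (s + 1))" using s0 by (simp add: t_def)
    have "0 \<le> Q (N + t *\<^sub>R S) (N + t *\<^sub>R S)" using psd sub that by blast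
    also have "\<dots> = 2 * t * q + t\<^sup>2 * s"
      using that(3) sym[OF that(1,2)] by (simp add: Q q_def s_def power2_eq_square distrib_left)
    also have "\<dots> = - (t\<^sup>2 * (s + 2))"
      unfolding qt by (simp add: power2_eq_square algebra_simps)
    finally have "t\<^sup>2 * (s + 2) \<le> 0" by simp
    then have "q = 0"
      using s0 qt by (simp add: mult_le_0_iff)
    then show ?thesis using sym that by (simp add: q_def)
  qed
  define T where "T = ?g \<inter> {A. transpose A = A} \<inter> sphere 0 1"
  have "closed {A :: real^'n^'n. transpose A = A}"
    by (rule closed_Collect_eq[OF linear_continuous_on[OF bounded_linear_transpose] continuous_on_id])
  then have "compact T"
    unfolding T_def
    by (intro closed_Int_compact closed_Int closed_subspace[OF subspace_lie_G] compact_sphere)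
  have pos: "0 < Q A A" if "A \<in> T" for A
  proof -
    have "A \<notin> lie_algebra K"
    proof
      assume "A \<in> lie_algebra K"
      then have "transpose A = - A" by (rule lie_K_skew)
      moreover have "transpose A = A" using that by (simp add: T_def)
      ultimately have "A + A = 0" by (metis add.right_inverse)
      then have "A = 0" by (simp flip: scaleR_2)
      then show False using that by (auto simp: T_def)
    qed
    then have "Q A A \<noteq> 0" using null that by (auto simp: T_def)
    moreover have "0 \<le> Q A A" using psd that by (auto simp: T_def)
    ultimately show ?thesis by simp
  qed
  \<comment> \<open>The minimum over the compact set \<open>T\<close>; any positive constant serves
    if \<open>T\<close> is empty.\<close>
  have "\<exists>m>0. \<forall>A\<in>T. m \<le> Q A A"
  proof (cases "T = {}")
    case False
    have "continuous_on T (\<lambda>A. Q A A)"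
      using bilinear_continuous_on_compose[OF _ _ bil, of T id id] by (simp add: continuous_on_id id_def)
    from continuous_attains_inf[OF \<open>compact T\<close> False this]
    obtain A where "A \<in> T" "\<forall>B\<in>T. Q A A \<le> Q B B" by blast
    with pos show ?thesis by blast
  qed (auto intro: exI[of _ 1])
  then obtain m where m: "m > 0" "\<And>A. A \<in> T \<Longrightarrow> m \<le> Q A A" by auto
  have main: "sqrt m / 2 * norm (A + transpose A) \<le> sqrt (Q A A)" if A: "A \<in> ?g" for A
  proof -
    define S N where "S = (1/2) *\<^sub>R (A + transpose A)" and "N = (1/2) *\<^sub>R (A - transpose A)"
    have SN: "S \<in> ?g" "N \<in> ?g"
      unfolding S_def N_def using sub A transpose_in_lie_G by blast+
    have ASN: "A = S + N" by (simp add: S_def N_def vec_eq_iff field_simps)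
    have "transpose N = - N"
      by (simp add: N_def transpose_scalar transpose_diff scaleR_diff_right)
    then have "N \<in> lie_algebra K" using skew_in_lie_K SN by blast
    then have "Q N N = 0" using null SN by blast
    then have eq: "Q A A = Q S S"
      using cross[OF SN \<open>Q N N = 0\<close>] sym[OF SN] \<open>Q N N = 0\<close> by (simp add: ASN Q)
    have "m * (norm S)\<^sup>2 \<le> Q S S"
    proof (cases "S = 0")
      case False
      have "transpose S = S" by (simp add: S_def transpose_scalar transpose_add add.commute)
      moreover have "(1 / norm S) *\<^sub>R S \<in> ?g" using sub(2) SN(1) by blast
      ultimately have "(1 / norm S) *\<^sub>R S \<in> T"
        using False by (simp add: T_def transpose_scalar)
      from m(2)[OF this] have "m \<le> Q S S / (norm S)\<^sup>2"
        by (simp add: Q power2_eq_square)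
      then show ?thesis using False by (simp add: field_simps)
    qed (use psd SN in auto)
    then have "sqrt (m * (norm S)\<^sup>2) \<le> sqrt (Q A A)" unfolding eq by (rule real_sqrt_le_mono)
    moreover have "norm S = norm (A + transpose A) / 2" by (simp add: S_def)
    ultimately show ?thesis by (simp add: real_sqrt_mult)
  qed
  show ?thesis
    using that[of "sqrt m / 2"] m(1) main psd by simp
qed

end

section \<open>Lower and upper estimates of the distance\<close>

context self_adjoint_group_pair
begin

text \<open>
  Along a curve, the logarithm of the Frobenius norm grows at most at the rate of the symmetric
  part of the left logarithmic derivative.
\<close>

lemma curve_length_lower_bound:
  assumes "c \<ge> 0" "\<And>A. A \<in> lie_algebra G \<Longrightarrow> c * norm (A + transpose A) \<le> sqrt (Q A A)"
    and "x \<in> G" "y \<in> G" "L \<in> curve_lengths G Q (left_coset K x) (left_coset K y)"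
  shows "2 * c * (ln (norm (matrix_inv x ** y)) - ln (norm (mat 1 :: real^'n^'n))) \<le> L"
proof -
  obtain \<gamma> where vp: "valid_path \<gamma>" and img: "path_image \<gamma> \<subseteq> G"
    and ends: "pathstart \<gamma> \<in> left_coset K x" "pathfinish \<gamma> \<in> left_coset K y"
    and L: "(curve_speed Q \<gamma> has_integral L) {0..1}"
    using assms(5) unfolding curve_lengths_def by blast
  obtain S D where "finite S" and D: "\<And>t. t \<in> {0..1} - S \<Longrightarrow> (\<gamma> has_vector_derivative D t) (at t)"
    and cont: "continuous_on {0..1} \<gamma>"
    using vp unfolding valid_path_def piecewise_C1_differentiable_on_def C1_differentiable_on_def
    by blast
  have gG: "\<gamma> t \<in> G" if "t \<in> {0..1}" for t
    using img that by (auto simp: path_image_def)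
  \<comment> \<open>Left translation moves the start to \<open>mat 1\<close>, so the growth of
    \<phi> compares \<open>matrix_inv x ** y\<close> with the identity; orthogonality of
    \<open>K\<close> absorbs the choice of endpoints in the cosets. As \<phi> is the logarithm of
    the squared norm, the factor 2 appears.\<close>
  define g where "g = matrix_inv (\<gamma> 0)"
  define M where "M t = g ** \<gamma> t" for t
  define \<phi> where "\<phi> t = ln (M t \<bullet> M t)" for t
  define \<phi>' where "\<phi>' t = 2 * (M t \<bullet> (g ** D t)) / (M t \<bullet> M t)" for t
  have MG: "M t \<in> G" if "t \<in> {0..1}" for t
    using that by (auto simp: M_def g_def intro!: mult_in_G inv_in_G gG)
  have zero_not: "(0 :: real^'n^'n) \<notin> G"
  proof
    assume "(0 :: real^'n^'n) \<in> G"
    then obtain B :: "real^'n^'n" where "0 ** B = mat 1"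
      using invertible_G invertible_right_inverse by blast
    then have "(mat 1 :: real^'n^'n) = 0"
      by (simp add: bounded_bilinear.zero_left[OF bounded_bilinear_matrix_mult])
    then have "(mat 1 :: real^'n^'n) $ i $ i = 0" for i by simp
    then show False by (simp add: mat_def)
  qed
  have Mpos: "0 < M t \<bullet> M t" if "t \<in> {0..1}" for t
    using MG[OF that] zero_not by auto
  have contM: "continuous_on {0..1} M"
    unfolding M_def by (intro continuous_on_matrix_mult continuous_intros cont)
  have int: "(\<phi>' has_integral (\<phi> 1 - \<phi> 0)) {0..1}"
  proof (rule fundamental_theorem_of_calculus_interior_strong[OF \<open>finite S\<close>])
    show "continuous_on {0..1} \<phi>"
      unfolding \<phi>_def using Mpos by (intro continuous_intros contM) force+
    fix t assume t: "t \<in> {0<..<1} - S"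
    have "(M has_vector_derivative g ** D t) (at t)"
      unfolding M_def
      using has_vector_derivative_matrix_mult[OF has_vector_derivative_const[of g] D[of t]] t
      by (simp add: bounded_bilinear.zero_left[OF bounded_bilinear_matrix_mult])
    from bounded_bilinear.has_vector_derivative[OF bounded_bilinear_inner this this]
    have "((\<lambda>t. M t \<bullet> M t) has_real_derivative 2 * (M t \<bullet> (g ** D t))) (at t)"
      by (simp add: has_real_derivative_iff_has_vector_derivative inner_commute)
    then have "(\<phi> has_real_derivative \<phi>' t) (at t)"
      unfolding \<phi>_def \<phi>'_def
      using Mpos[of t] t by (auto intro!: derivative_eq_intros)
    then show "(\<phi> has_vector_derivative \<phi>' t) (at t)"
      by (simp add: has_real_derivative_iff_has_vector_derivative)
  qed simp
  have speed: "c * \<phi>' t \<le> curve_speed Q \<gamma> t" if t: "t \<in> {0<..<1} - S" for t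
  proof -
    define A where "A = matrix_inv (\<gamma> t) ** D t"
    have Dt: "(\<gamma> has_vector_derivative D t) (at t)" using D t by auto
    have "M t ** A = g ** (\<gamma> t ** matrix_inv (\<gamma> t)) ** D t"
      by (simp add: M_def A_def matrix_mul_assoc)
    then have "g ** D t = M t ** A"
      using matrix_inv_right[OF invertible_G[OF gG[of t]]] t by simp
    then have "\<phi>' t * (M t \<bullet> M t) = M t \<bullet> (M t ** A) + M t \<bullet> (M t ** A)"
      using Mpos[of t] t by (simp add: \<phi>'_def)
    also have "\<dots> = M t \<bullet> (M t ** (A + transpose A))"
      using inner_matrix_mult_transpose[of "M t" A] by (simp add: matrix_add_ldistrib inner_add_right)
    also have "\<dots> \<le> norm (M t) * (norm (M t) * norm (A + transpose A))"
      by (rule order_trans[OF norm_cauchy_schwarz mult_left_mono[OF norm_matrix_mult_le]]) simp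
    finally have "\<phi>' t * (M t \<bullet> M t) \<le> norm (A + transpose A) * (M t \<bullet> M t)"
      by (simp add: power2_norm_eq_inner[symmetric] power2_eq_square algebra_simps)
    then have "\<phi>' t \<le> norm (A + transpose A)"
      using Mpos[of t] t by simp
    then have "c * \<phi>' t \<le> c * norm (A + transpose A)" using assms(1) by (rule mult_left_mono)
    also have "\<dots> \<le> sqrt (Q A A)"
      using left_logarithmic_derivative_in_lie_G[OF Dt _ _ gG] t
      unfolding A_def by (intro assms(2)) auto
    also have "\<dots> = curve_speed Q \<gamma> t"
      using vector_derivative_at_within_ivl[OF Dt, of 0 1] t
      by (simp add: curve_speed_def Let_def A_def)
    finally show ?thesis .
  qed
  \<comment> \<open>At 0, 1 and the finitely many points of \<open>S\<close> the speed is not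
    controlled. Replacing it there leaves the integral unchanged.\<close>
  define v where "v t = (if t \<in> {0<..<1} - S then curve_speed Q \<gamma> t else c * \<phi>' t)" for t
  have v: "(v has_integral L) {0..1}"
    by (rule has_integral_spike_finite[of "insert 0 (insert 1 S)", OF _ _ L])
      (use \<open>finite S\<close> in \<open>auto simp: v_def\<close>)
  have "c * \<phi>' t \<le> v t" for t
    using speed by (simp add: v_def)
  then have "c * (\<phi> 1 - \<phi> 0) \<le> L"
    by (intro has_integral_le[OF has_integral_mult_right[OF int] v])
  moreover have "M 0 = mat 1"
    using matrix_inv_left[OF invertible_G[OF gG[of 0]]] by (simp add: M_def g_def)
  moreover have "norm (M 1) = norm (matrix_inv x ** y)"
  proof -
    obtain k l where kl: "k \<in> K" "l \<in> K" "\<gamma> 0 = x ** k" "\<gamma> 1 = y ** l"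
      using ends by (auto simp: left_coset_def pathstart_def pathfinish_def)
    have ok: "transpose k ** k = mat 1" "k ** transpose k = mat 1"
      using orthogonal_K[OF kl(1)] by (auto simp: orthogonal_matrix_def)
    have "matrix_inv k = transpose k" using ok(2) by (rule matrix_inv_unique)
    moreover have "invertible k" using ok invertible_def by blast
    ultimately have "matrix_inv (x ** k) = transpose k ** matrix_inv x"
      using matrix_inv_mult[OF invertible_G[OF assms(3)], of k] by simp
    then have "M 1 = transpose k ** (matrix_inv x ** y) ** l"
      unfolding M_def g_def kl by (simp only: matrix_mul_assoc)
    then show ?thesis
      using orthogonal_K kl by (simp add: norm_mult_orthogonal_left norm_mult_orthogonal_right)
  qed
  moreover have "\<phi> t = 2 * ln (norm (M t))" if "t \<in> {0..1}" for t
    using Mpos[OF that] by (simp add: \<phi>_def power2_norm_eq_inner[symmetric] ln_realpow)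
  ultimately show ?thesis by (simp add: algebra_simps)
qed

text \<open>Both estimates come from one bound with a coefficient \<open>a\<close> between 0 and the
  coercivity constant: the largest \<open>a\<close> gives the logarithm, and a = 0 gives
  nonnegativity.\<close>

lemma riemannian_dist_lower_bound:
  assumes "invariant_riemannian_metric G K Q"
  obtains c where "c > 0"
    "\<And>x y. x \<in> G \<Longrightarrow> y \<in> G \<Longrightarrow> curve_lengths G Q (left_coset K x) (left_coset K y) \<noteq> {} \<Longrightarrow>
       c * (ln (norm (matrix_inv x ** y)) - ln (norm (mat 1 :: real^'n^'n)))
         \<le> riemannian_dist G Q (left_coset K x) (left_coset K y)"
    "\<And>x y. x \<in> G \<Longrightarrow> y \<in> G \<Longrightarrow> curve_lengths G Q (left_coset K x) (left_coset K y) \<noteq> {} \<Longrightarrow>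
       0 \<le> riemannian_dist G Q (left_coset K x) (left_coset K y)"
proof -
  obtain c where c: "c > 0"
    "\<And>A. A \<in> lie_algebra G \<Longrightarrow> c * norm (A + transpose A) \<le> sqrt (Q A A)"
    "\<And>A. A \<in> lie_algebra G \<Longrightarrow> 0 \<le> Q A A"
    using metric_coercive[OF assms] by metis
  have bound: "2 * a * (ln (norm (matrix_inv x ** y)) - ln (norm (mat 1 :: real^'n^'n)))
      \<le> riemannian_dist G Q (left_coset K x) (left_coset K y)"
    if "0 \<le> a" "a \<le> c" "x \<in> G" "y \<in> G"
      and "curve_lengths G Q (left_coset K x) (left_coset K y) \<noteq> {}" for a x y
  proof -
    have "a * norm (A + transpose A) \<le> sqrt (Q A A)" if "A \<in> lie_algebra G" for A
      using mult_right_mono[OF \<open>a \<le> c\<close> norm_ge_zero] c(2)[OF that] by (rule order_trans)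
    then show ?thesis
      unfolding riemannian_dist_def curve_lengths_def[symmetric]
      using that curve_length_lower_bound[of a Q x y] by (intro cInf_greatest) auto
  qed
  show ?thesis
  proof (rule that[of "2 * c"])
    show "2 * c > 0" using c(1) by simp
    fix x y assume xy: "x \<in> G" "y \<in> G"
      and "curve_lengths G Q (left_coset K x) (left_coset K y) \<noteq> {}"
    note bound = bound[OF _ _ this]
    show "2 * c * (ln (norm (matrix_inv x ** y)) - ln (norm (mat 1 :: real^'n^'n)))
        \<le> riemannian_dist G Q (left_coset K x) (left_coset K y)"
      using bound[of c] c(1) by simp
    show "0 \<le> riemannian_dist G Q (left_coset K x) (left_coset K y)"
      using bound[of 0] c(1) by simp
  qed
qed

text \<open>A curve with derivative \<gamma> A has the Q-norm of A as its speed, at most a constant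
  times the Frobenius norm. The majorant \<open>v\<close> allows lengths to be bounded by explicit
  integrals.\<close>

lemma riemannian_dist_upper_bound:
  assumes "invariant_riemannian_metric G K Q"
  obtains B where "B > 0"
    "\<And>\<gamma> A v I. (\<And>t. t \<in> {0..1} \<Longrightarrow> \<gamma> t \<in> G) \<Longrightarrow>
       (\<And>t. t \<in> {0..1} \<Longrightarrow> (\<gamma> has_vector_derivative \<gamma> t ** A t) (at t within {0..1})) \<Longrightarrow>
       continuous_on {0..1} A \<Longrightarrow> (\<And>t. t \<in> {0..1} \<Longrightarrow> norm (A t) \<le> v t) \<Longrightarrow>
       (v has_integral I) {0..1} \<Longrightarrow>
       curve_lengths G Q (left_coset K (\<gamma> 0)) (left_coset K (\<gamma> 1)) \<noteq> {} \<and>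
       riemannian_dist G Q (left_coset K (\<gamma> 0)) (left_coset K (\<gamma> 1)) \<le> B * I"
proof -
  have bil: "bilinear Q" using assms unfolding invariant_riemannian_metric_def by auto
  obtain B where B: "B > 0" "\<And>A. \<bar>Q A A\<bar> \<le> B * norm A * norm A"
    using bilinear_bounded_pos[OF bil] by auto
  obtain c where c: "c > 0"
    "\<And>A. A \<in> lie_algebra G \<Longrightarrow> c * norm (A + transpose A) \<le> sqrt (Q A A)"
    using metric_coercive[OF assms] by metis
  show ?thesis
  proof (rule that[of "sqrt B"])
    show "sqrt B > 0" using B by simp
    fix \<gamma> A v I
    assume G: "\<And>t. t \<in> {0..1} \<Longrightarrow> \<gamma> t \<in> G"
      and d: "\<And>t. t \<in> {0..1} \<Longrightarrow> (\<gamma> has_vector_derivative \<gamma> t ** A t) (at t within {0..1})"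
      and contA: "continuous_on {0..1} A" and v: "\<And>t. t \<in> {0..1} \<Longrightarrow> norm (A t) \<le> v t"
      and I: "(v has_integral I) {0..1}"
    have cont: "continuous_on {0..1} \<gamma>"
      using d has_vector_derivative_continuous continuous_on_eq_continuous_within by blast
    have "valid_path \<gamma>"
      unfolding valid_path_def piecewise_C1_differentiable_on_def C1_differentiable_on_def
    \<comment> \<open>The endpoints count as break points because the derivative is one-sided
      there.\<close>
    proof (intro conjI exI[of _ "{0,1}"] exI[of _ "\<lambda>t. \<gamma> t ** A t"])
      show "\<forall>t\<in>{0..1} - {0,1}. (\<gamma> has_vector_derivative \<gamma> t ** A t) (at t)"
      proof
        fix t :: real assume t: "t \<in> {0..1} - {0,1}"
        then have "t \<in> interior {0..1}" by auto
        then show "(\<gamma> has_vector_derivative \<gamma> t ** A t) (at t)"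
          using d[of t] t at_within_interior[of t "{0..1}"] by auto
      qed
      show "continuous_on ({0..1} - {0,1}) (\<lambda>t. \<gamma> t ** A t)"
        by (rule continuous_on_subset[OF continuous_on_matrix_mult[OF cont contA]]) auto
    qed (use cont in auto)
    have speed: "curve_speed Q \<gamma> t = sqrt (Q (A t) (A t))" if t: "t \<in> {0..1}" for t
      using vector_derivative_within_closed_interval[OF _ t d[OF t]]
        matrix_inv_left[OF invertible_G[OF G[OF t]]]
      by (simp add: curve_speed_def Let_def matrix_mul_assoc)
    have "continuous_on {0..1} (\<lambda>t. sqrt (Q (A t) (A t)))"
      using bilinear_continuous_on_compose[OF contA contA bil] by (intro continuous_intros)
    then have "curve_speed Q \<gamma> integrable_on {0..1}"
      by (rule integrable_eq[OF integrable_continuous_interval]) (simp only: speed)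
    then obtain L where L: "(curve_speed Q \<gamma> has_integral L) {0..1}"
      by (auto simp: integrable_on_def)
    have LI: "L \<le> sqrt B * I"
    proof (rule has_integral_le[OF L has_integral_mult_right[OF I]])
      fix t :: real assume t: "t \<in> {0..1}"
      have "sqrt (Q (A t) (A t)) \<le> sqrt (B * norm (A t) * norm (A t))"
        using B(2)[of "A t"] by (intro real_sqrt_le_mono) auto
      also have "\<dots> = sqrt B * norm (A t)"
        by (simp add: real_sqrt_mult mult.assoc)
      also have "\<dots> \<le> sqrt B * v t" using v[OF t] B(1) by simp
      finally show "curve_speed Q \<gamma> t \<le> sqrt B * v t" unfolding speed[OF t] .
    qed
    have mem: "L \<in> curve_lengths G Q (left_coset K (\<gamma> 0)) (left_coset K (\<gamma> 1))"
      unfolding curve_lengths_def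
    proof (intro CollectI exI[of _ \<gamma>] conjI L \<open>valid_path \<gamma>\<close>)
      show "path_image \<gamma> \<subseteq> G" using G by (auto simp: path_image_def)
      show "pathstart \<gamma> \<in> left_coset K (\<gamma> 0)" "pathfinish \<gamma> \<in> left_coset K (\<gamma> 1)"
        unfolding left_coset_def pathstart_def pathfinish_def
        using one_in_K by (auto intro: image_eqI[of _ _ "mat 1"])
    qed
    \<comment> \<open>\<open>cInf_lower\<close> needs some lower bound on all lengths; the
      logarithmic estimate supplies it.\<close>
    have "bdd_below (curve_lengths G Q (left_coset K (\<gamma> 0)) (left_coset K (\<gamma> 1)))"
      by (rule bdd_belowI, rule curve_length_lower_bound[of c Q, OF less_imp_le[OF c(1)] c(2)]) (auto intro: G)
    then have "riemannian_dist G Q (left_coset K (\<gamma> 0)) (left_coset K (\<gamma> 1)) \<le> L"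
      unfolding riemannian_dist_def curve_lengths_def[symmetric] by (intro cInf_lower mem)
    then show "curve_lengths G Q (left_coset K (\<gamma> 0)) (left_coset K (\<gamma> 1)) \<noteq> {} \<and>
       riemannian_dist G Q (left_coset K (\<gamma> 0)) (left_coset K (\<gamma> 1)) \<le> sqrt B * I"
      using LI mem by auto
  qed
qed

end

section \<open>The special linear and symplectic groups\<close>

subsection \<open>The Cayley transform\<close>

text \<open>A rational substitute for the exponential: it sends skew matrices to rotations and keeps
  commutation with a fixed matrix, and so supplies the curves that place skew matrices in the Lie
  algebras of SO and U.\<close>

definition cayley :: "real^'n^'n \<Rightarrow> real^'n^'n" where
  "cayley A = (mat 1 + A) ** matrix_inv (mat 1 - A)"

lemma skew_quadratic_form_zero:
  fixes A :: "real^'n^'n"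
  assumes "transpose A = - A"
  shows "x \<bullet> (A *v x) = 0"
proof -
  have "x \<bullet> (A *v x) = (transpose A *v x) \<bullet> x"
    by (simp add: dot_lmul_matrix)
  also have "\<dots> = - (x \<bullet> (A *v x))"
    unfolding assms by (simp add: matrix_vector_mult_def inner_vec_def sum_negf mult.commute)
  finally show ?thesis by simp
qed

text \<open>A kernel vector satisfies x \<bullet> x = x \<bullet> A x, and the right side vanishes
  for skew \<open>A\<close>.\<close>

lemma invertible_one_minus_skew:
  fixes A :: "real^'n^'n"
  assumes "transpose A = - A"
  shows "invertible (mat 1 - A)"
proof -
  have "x = 0" if "(mat 1 - A) *v x = 0" for x
  proof -
    have "x \<bullet> x = x \<bullet> (A *v x)"
      using arg_cong[OF that, of "\<lambda>y. x \<bullet> y"]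
      by (simp add: matrix_vector_mult_diff_rdistrib inner_diff_right)
    then show ?thesis using skew_quadratic_form_zero[OF assms, of x] by simp
  qed
  then show ?thesis
    using invertible_left_inverse matrix_left_invertible_ker by blast
qed

text \<open>The cross terms vanish by skewness, leaving the squared norms of M and A M. With M the
  inverse of 1 - A this bounds that inverse uniformly in A.\<close>

lemma norm_one_minus_skew_mult:
  fixes A M :: "real^'n^'n"
  assumes "transpose A = - A"
  shows "norm M \<le> norm ((mat 1 - A) ** M)"
proof (rule norm_le[THEN iffD2])
  have "M \<bullet> (A ** M) = transpose M \<bullet> (transpose M ** transpose A)"
    by (simp add: inner_vec_def transpose_def matrix_matrix_mult_def mult.commute)
      (subst sum.swap, simp)
  moreover have "transpose M \<bullet> (transpose M ** transpose A) = transpose M \<bullet> (transpose M ** A)"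
    using inner_matrix_mult_transpose by metis
  ultimately have "M \<bullet> (A ** M) = 0"
    using assms by (simp add: matrix_mult_linear_simps)
  then show "M \<bullet> M \<le> ((mat 1 - A) ** M) \<bullet> ((mat 1 - A) ** M)"
    by (simp add: matrix_mult_linear_simps inner_diff_left inner_diff_right inner_commute)
qed

context
  fixes A :: "real^'n^'n"
  assumes skew: "transpose A = - A"
begin

lemma one_plus_skew: "mat 1 + A = transpose (mat 1 - A)"
  by (simp add: transpose_diff skew)

text \<open>1 + A and 1 - A commute and are transposes of each other.\<close>

lemma transpose_cayley_mult_cayley: "transpose (cayley A) ** cayley A = mat 1"
proof -
  let ?N = "mat 1 - A" and ?P = "mat 1 + A"
  have PN: "?P ** ?N = ?N ** ?P" by (simp add: matrix_mult_linear_simps)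
  have tP: "transpose ?P = ?N" using one_plus_skew transpose_transpose by metis
  note inv = invertible_one_minus_skew[OF skew]
  have "transpose (cayley A) ** cayley A =
      transpose (matrix_inv ?N) ** (?N ** ?P) ** matrix_inv ?N"
    by (simp add: cayley_def matrix_transpose_mul tP matrix_mul_assoc)
  also have "\<dots> = (transpose (matrix_inv ?N) ** transpose ?N) ** (?N ** matrix_inv ?N)"
    unfolding PN[symmetric] by (simp only: one_plus_skew matrix_mul_assoc)
  also have "\<dots> = transpose (?N ** matrix_inv ?N)"
    by (simp add: matrix_transpose_mul[symmetric] matrix_inv_right[OF inv])
  finally show ?thesis by (simp add: matrix_inv_right[OF inv])
qed

lemma det_cayley: "det (cayley A) = 1"
  using invertible_one_minus_skew[OF skew]
  by (simp add: cayley_def det_mul one_plus_skew det_matrix_inv invertible_det_nz)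

lemma cayley_commute:
  assumes "J ** A = A ** J"
  shows "J ** cayley A = cayley A ** J"
proof -
  let ?N = "mat 1 - A" and ?P = "mat 1 + A"
  note inv = invertible_one_minus_skew[OF skew]
  have "matrix_inv ?N ** J = matrix_inv ?N ** (J ** ?N) ** matrix_inv ?N"
    by (simp add: matrix_inv_right[OF inv] flip: matrix_mul_assoc)
  also have "J ** ?N = ?N ** J" using assms by (simp add: matrix_mult_linear_simps)
  also have "matrix_inv ?N ** (?N ** J) ** matrix_inv ?N = J ** matrix_inv ?N"
    by (simp add: matrix_inv_left[OF inv] matrix_mul_assoc)
  finally have NJ: "matrix_inv ?N ** J = J ** matrix_inv ?N" .
  have "J ** cayley A = ?P ** (J ** matrix_inv ?N)"
    using assms by (simp add: cayley_def matrix_mult_linear_simps matrix_mul_assoc)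
  then show ?thesis by (simp add: NJ[symmetric] cayley_def matrix_mul_assoc)
qed

end

text \<open>The argument is halved because \<open>cayley B\<close> is 1 + 2 B to first order. The
  error is exactly t^2/2 A^2 (1 - t A/2)^(-1), where the inverse is bounded independently of
  t.\<close>

lemma cayley_has_vector_derivative:
  fixes A :: "real^'n^'n"
  assumes skew: "transpose A = - A"
  shows "((\<lambda>t. cayley ((t/2) *\<^sub>R A)) has_vector_derivative A) (at 0)"
  unfolding has_vector_derivative_def
proof (rule has_derivativeI_sandwich[of 1])
  define e where "e = norm A * norm A * norm (mat 1 :: real^'n^'n)"
  have e0: "0 \<le> e" by (simp add: e_def)
  show "bounded_linear (\<lambda>t. t *\<^sub>R A)" by (rule bounded_linear_scaleR_left)
  show "((\<lambda>t::real. \<bar>t\<bar> * e) \<longlongrightarrow> 0) (at 0 within UNIV)"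
    by (auto intro!: tendsto_eq_intros)
  fix t :: real assume "t \<noteq> 0"
  define N where "N = mat 1 - (t/2) *\<^sub>R A"
  have skt: "transpose ((t/2) *\<^sub>R A) = - ((t/2) *\<^sub>R A)"
    using skew by (simp add: transpose_scalar)
  have inv: "N ** matrix_inv N = mat 1"
    unfolding N_def by (intro matrix_inv_right invertible_one_minus_skew skt)
  have Nle: "norm (matrix_inv N) \<le> norm (mat 1 :: real^'n^'n)"
    using norm_one_minus_skew_mult[OF skt, of "matrix_inv N"] inv by (simp add: N_def)
  have eq: "cayley ((t/2) *\<^sub>R A) - mat 1 - t *\<^sub>R A = (t * t / 2) *\<^sub>R (A ** A ** matrix_inv N)"
  proof -
    have "(mat 1 + (t/2) *\<^sub>R A) - N = t *\<^sub>R A"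
      by (simp add: N_def vec_eq_iff)
    then have "(mat 1 + (t/2) *\<^sub>R A) - N - t *\<^sub>R (A ** N) = (t * t / 2) *\<^sub>R (A ** A)"
      by (simp add: N_def matrix_mult_linear_simps scaleR_diff_right)
    then have "((mat 1 + (t/2) *\<^sub>R A) - N - t *\<^sub>R (A ** N)) ** matrix_inv N =
        (t * t / 2) *\<^sub>R (A ** A ** matrix_inv N)"
      by (simp add: matrix_mult_linear_simps)
    moreover have "A ** N ** matrix_inv N = A"
      by (simp add: inv flip: matrix_mul_assoc)
    ultimately show ?thesis
      by (simp add: cayley_def N_def[symmetric] matrix_mult_linear_simps inv)
  qed
  have "norm (A ** A ** matrix_inv N) \<le> norm A * norm A * norm (matrix_inv N)"
    by (rule order_trans[OF norm_matrix_mult_le mult_right_mono[OF norm_matrix_mult_le]]) simp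
  also have "\<dots> \<le> e"
    unfolding e_def by (intro mult_left_mono Nle) simp
  finally have "norm (A ** A ** matrix_inv N) \<le> e" .
  then have "norm (cayley ((t/2) *\<^sub>R A) - mat 1 - t *\<^sub>R A) \<le> t * t / 2 * e"
    unfolding eq by (simp add: mult_left_mono)
  also have "\<dots> \<le> (\<bar>t\<bar> * \<bar>t\<bar>) * e"
    using mult_nonneg_nonneg[OF e0 zero_le_square[of t]] by simp
  finally show "norm (cayley ((t/2) *\<^sub>R A) - cayley ((0/2) *\<^sub>R A) - (t - 0) *\<^sub>R A) / norm (t - 0) \<le> \<bar>t\<bar> * e"
    using \<open>t \<noteq> 0\<close> by (simp add: cayley_def[of 0] divide_le_eq mult_ac)
qed simp

subsection \<open>The special linear group\<close>

interpretation SL_SO: self_adjoint_group_pair "SL :: (real^'n^'n) set" SO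
proof
  fix g h :: "real^'n^'n" assume g: "g \<in> SL"
  show inv: "invertible g" using g by (simp add: SL_def invertible_det_nz)
  show "matrix_inv g \<in> SL" using g by (simp add: SL_def det_matrix_inv[OF inv])
  show "transpose g \<in> SL" using g by (simp add: SL_def)
  show "h \<in> SL \<Longrightarrow> g ** h \<in> SL" using g by (simp add: SL_def det_mul)
next
  fix A :: "real^'n^'n" assume "transpose A = - A"
  then have skt: "transpose ((t/2) *\<^sub>R A) = - ((t/2) *\<^sub>R A)" for t
    by (simp add: transpose_scalar)
  show "A \<in> lie_algebra SO"
    by (rule lie_algebraI[OF _ _ cayley_has_vector_derivative[OF \<open>transpose A = - A\<close>]])
      (simp_all add: cayley_def[of 0] SO_def rotation_matrix_def orthogonal_matrix
        transpose_cayley_mult_cayley[OF skt] det_cayley[OF skt])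
qed (simp_all add: SL_def SO_def rotation_matrix_def orthogonal_matrix_id)

subsection \<open>The symplectic group\<close>

definition block_matrix ::
    "real^'n^'n \<Rightarrow> real^'n^'n \<Rightarrow> real^'n^'n \<Rightarrow> real^'n^'n \<Rightarrow> real^('n::finite + 'n)^('n + 'n)" where
  "block_matrix a b c d =
     (\<chi> p q. case p of
        Inl i \<Rightarrow> (case q of Inl j \<Rightarrow> a $ i $ j | Inr j \<Rightarrow> b $ i $ j)
      | Inr i \<Rightarrow> (case q of Inl j \<Rightarrow> c $ i $ j | Inr j \<Rightarrow> d $ i $ j))"

lemma block_matrix_nth [simp]:
  "block_matrix a b c d $ Inl i $ Inl j = a $ i $ j"
  "block_matrix a b c d $ Inl i $ Inr j = b $ i $ j"
  "block_matrix a b c d $ Inr i $ Inl j = c $ i $ j"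
  "block_matrix a b c d $ Inr i $ Inr j = d $ i $ j"
  by (simp_all add: block_matrix_def)

lemma sum_UNIV_sum:
  "sum f (UNIV :: ('a::finite + 'b::finite) set) = (\<Sum>i\<in>UNIV. f (Inl i)) + (\<Sum>i\<in>UNIV. f (Inr i))"
  using sum.Plus[of "UNIV :: 'a set" "UNIV :: 'b set" f] by (simp add: o_def)

lemma sum_matrix_eq_iff:
  fixes A B :: "'a^('n::finite + 'n)^('n + 'n)"
  shows "A = B \<longleftrightarrow> (\<forall>i j. A $ Inl i $ Inl j = B $ Inl i $ Inl j \<and> A $ Inl i $ Inr j = B $ Inl i $ Inr j \<and>
     A $ Inr i $ Inl j = B $ Inr i $ Inl j \<and> A $ Inr i $ Inr j = B $ Inr i $ Inr j)"
  by (auto simp: vec_eq_iff split_sum_all)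

lemma block_matrix_eq_iff:
  "block_matrix a b c d = block_matrix a' b' c' d' \<longleftrightarrow> a = a' \<and> b = b' \<and> c = c' \<and> d = d'"
  by (auto simp: sum_matrix_eq_iff vec_eq_iff)

lemma block_matrix_cases:
  fixes g :: "real^('n::finite + 'n)^('n + 'n)"
  obtains a b c d where "g = block_matrix a b c d"
  by (rule that[of "\<chi> i j. g $ Inl i $ Inl j" "\<chi> i j. g $ Inl i $ Inr j"
        "\<chi> i j. g $ Inr i $ Inl j" "\<chi> i j. g $ Inr i $ Inr j"])
    (simp add: sum_matrix_eq_iff)

lemma block_matrix_mult:
  "block_matrix a b c d ** block_matrix a' b' c' d' =
   block_matrix (a ** a' + b ** c') (a ** b' + b ** d') (c ** a' + d ** c') (c ** b' + d ** d')"
  by (simp add: sum_matrix_eq_iff matrix_matrix_mult_def sum_UNIV_sum)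

lemma transpose_block_matrix:
  "transpose (block_matrix a b c d) =
   block_matrix (transpose a) (transpose c) (transpose b) (transpose d)"
  by (simp add: sum_matrix_eq_iff transpose_def)

lemma block_matrix_mat_1: "mat 1 = block_matrix (mat 1) 0 0 (mat 1)"
  by (simp add: sum_matrix_eq_iff mat_def)

definition symplectic_unit :: "real^('n::finite + 'n)^('n + 'n)" where
  "symplectic_unit = block_matrix 0 (mat 1) (- mat 1) 0"

lemma symplectic_unit_square: "symplectic_unit ** symplectic_unit = - mat 1"
  by (simp add: symplectic_unit_def block_matrix_mult matrix_mult_linear_simps)
    (simp add: sum_matrix_eq_iff mat_def)

lemma symplectic_form_matrix: "symplectic_form x y = x \<bullet> (symplectic_unit *v y)"
  by (simp add: symplectic_form_def symplectic_unit_def inner_vec_def matrix_vector_mult_def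
      sum_UNIV_sum mat_def if_distrib[of "\<lambda>c. c * _"] if_distrib[of "\<lambda>c. - c"] sum_subtractf sum_negf
      cong: if_cong)

lemma Sp_iff: "g \<in> Sp \<longleftrightarrow> transpose g ** symplectic_unit ** g = symplectic_unit"
proof -
  let ?J = "symplectic_unit :: real^('a + 'a)^('a + 'a)"
  have form: "(g *v x) \<bullet> (?J *v (g *v y)) = x \<bullet> ((transpose g ** ?J ** g) *v y)" for x y
  proof -
    have "(g *v x) \<bullet> z = x \<bullet> (transpose g *v z)" for z
      unfolding transpose_matrix_vector by (subst (1 2) inner_commute) (rule dot_lmul_matrix[symmetric])
    then show ?thesis by (simp only: matrix_vector_mul_assoc matrix_mul_assoc)
  qed
  show ?thesis
  proof
    assume "g \<in> Sp"
    then have *: "x \<bullet> ((transpose g ** ?J ** g) *v y) = x \<bullet> (?J *v y)" for x y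
      by (simp only: Sp_def symplectic_form_matrix form mem_Collect_eq)
    then have "(transpose g ** ?J ** g) *v y = ?J *v y" for y
      by (rule vector_eq_ldot[THEN iffD1, OF allI])
    then show "transpose g ** ?J ** g = ?J"
      unfolding matrix_eq by blast
  next
    assume *: "transpose g ** ?J ** g = ?J"
    \<comment> \<open>Since J squares to -1, the negative of J g^T J is a left inverse of
      \<open>g\<close>.\<close>
    have "?J ** (transpose g ** ?J ** g) = - mat 1"
      unfolding * by (rule symplectic_unit_square)
    then have "(- (?J ** transpose g ** ?J)) ** g = mat 1"
      by (simp add: matrix_mult_linear_simps matrix_mul_assoc)
    then have "invertible g" using invertible_left_inverse by blast
    then show "g \<in> Sp"
      by (simp only: Sp_def symplectic_form_matrix form * mem_Collect_eq simp_thms)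
  qed
qed

text \<open>The left inverse - J g^T J of a square matrix is also a right inverse, and this
  rearranges to g J g^T = J.\<close>

lemma transpose_in_Sp:
  assumes "g \<in> Sp"
  shows "transpose g \<in> Sp"
proof -
  let ?J = symplectic_unit
  have inv: "invertible g" using assms by (simp add: Sp_def)
  have *: "transpose g ** ?J ** g = ?J" using assms by (simp add: Sp_iff)
  have "(- (?J ** transpose g ** ?J)) ** g = - (?J ** (transpose g ** ?J ** g))"
    by (simp add: matrix_mult_linear_simps matrix_mul_assoc)
  then have "(- (?J ** transpose g ** ?J)) ** g = mat 1"
    by (simp add: * symplectic_unit_square)
  then have "g ** (- (?J ** transpose g ** ?J)) = mat 1"
    using matrix_left_right_inverse by blast
  then have "g ** (- (?J ** transpose g ** ?J)) ** ?J = ?J" by simp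
  moreover have "g ** (- (?J ** transpose g ** ?J)) ** ?J = - (g ** ?J ** transpose g ** (?J ** ?J))"
    by (simp add: matrix_mult_linear_simps matrix_mul_assoc)
  ultimately have "g ** ?J ** transpose g = ?J"
    by (simp add: symplectic_unit_square matrix_mult_linear_simps)
  then show ?thesis by (simp add: Sp_iff)
qed

subsection \<open>The unitary group\<close>

definition conj_transpose :: "complex^'n^'n \<Rightarrow> complex^'n^'n" where
  "conj_transpose u = (\<chi> i j. cnj (u $ j $ i))"

lemma realification_block_matrix:
  "realification u =
   block_matrix (\<chi> i j. Re (u $ i $ j)) (\<chi> i j. - Im (u $ i $ j)) (\<chi> i j. Im (u $ i $ j)) (\<chi> i j. Re (u $ i $ j))"
  by (simp add: realification_def sum_matrix_eq_iff)

lemma realification_mult: "realification (u ** v) = realification u ** realification v"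
  unfolding realification_block_matrix block_matrix_mult block_matrix_eq_iff
  by (simp add: vec_eq_iff matrix_matrix_mult_def sum_subtractf sum.distrib sum_negf algebra_simps)

lemma realification_conj_transpose: "realification (conj_transpose u) = transpose (realification u)"
  unfolding realification_block_matrix transpose_block_matrix block_matrix_eq_iff
  by (simp add: vec_eq_iff transpose_def conj_transpose_def)

lemma realification_mat_1: "realification (mat 1) = mat 1"
  unfolding realification_block_matrix block_matrix_mat_1 block_matrix_eq_iff
  by (simp add: vec_eq_iff mat_def)

lemma realification_inject: "realification u = realification v \<longleftrightarrow> u = v"
  unfolding realification_block_matrix block_matrix_eq_iff
  by (auto simp: vec_eq_iff complex_eq_iff)

text \<open>\<open>realification\<close> is injective and multiplicative and takes the conjugate
  transpose to the transpose, so each defining equation transfers both ways.\<close>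

lemma unitary_matrix_iff: "unitary_matrix u \<longleftrightarrow> orthogonal_matrix (realification u)"
  unfolding unitary_matrix_def orthogonal_matrix_def conj_transpose_def[symmetric]
  by (metis realification_mult realification_conj_transpose realification_mat_1 realification_inject)

text \<open>Commuting with J is complex linearity: it forces equal diagonal blocks and opposite
  off-diagonal blocks.\<close>

lemma orthogonal_commuting_in_U:
  assumes "orthogonal_matrix g" "symplectic_unit ** g = g ** symplectic_unit"
  shows "g \<in> U"
proof -
  obtain a b c d where g: "g = block_matrix a b c d" by (rule block_matrix_cases)
  have "0 ** a + mat 1 ** c = a ** 0 + b ** (- mat 1)" "0 ** b + mat 1 ** d = a ** mat 1 + b ** 0"
    using assms(2) unfolding g symplectic_unit_def block_matrix_mult block_matrix_eq_iff by blast+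
  then have "c = - b" "d = a"
    by (simp_all add: matrix_mult_linear_simps)
  then have "g = realification (\<chi> i j. Complex (a $ i $ j) (- b $ i $ j))"
    unfolding g realification_block_matrix block_matrix_eq_iff by (simp add: vec_eq_iff)
  then show ?thesis using assms(1) by (auto simp: U_def unitary_matrix_iff)
qed

interpretation Sp_U: self_adjoint_group_pair "Sp :: (real^('n::finite + 'n)^('n + 'n)) set" U
proof
  fix g h :: "real^('n + 'n)^('n + 'n)" assume g: "g \<in> Sp"
  show inv: "invertible g" using g by (simp add: Sp_def)
  show "transpose g \<in> Sp" by (rule transpose_in_Sp[OF g])
  show "h \<in> Sp \<Longrightarrow> g ** h \<in> Sp"
    using g by (simp add: Sp_def invertible_mult flip: matrix_vector_mul_assoc)
  have "symplectic_form (matrix_inv g *v x) (matrix_inv g *v y) = symplectic_form x y" for x y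
  proof -
    have "symplectic_form (matrix_inv g *v x) (matrix_inv g *v y) =
        symplectic_form (g *v (matrix_inv g *v x)) (g *v (matrix_inv g *v y))"
      using g by (simp add: Sp_def)
    then show ?thesis
      by (simp only: matrix_vector_mul_assoc matrix_inv_right[OF inv] matrix_vector_mul_lid)
  qed
  then show "matrix_inv g \<in> Sp"
    by (simp add: Sp_def invertible_matrix_inv[OF inv])
next
  show "mat 1 \<in> (Sp :: (real^('n + 'n)^('n + 'n)) set)" by (simp add: Sp_iff)
  show "mat 1 \<in> (U :: (real^('n + 'n)^('n + 'n)) set)"
    by (rule orthogonal_commuting_in_U) (simp_all add: orthogonal_matrix_id)
  show "k \<in> U \<Longrightarrow> orthogonal_matrix k" for k :: "real^('n + 'n)^('n + 'n)"
    by (auto simp: U_def unitary_matrix_iff)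
next
  fix A :: "real^('n + 'n)^('n + 'n)"
  let ?J = "symplectic_unit :: real^('n + 'n)^('n + 'n)"
  assume "A \<in> lie_algebra Sp" and skew: "transpose A = - A"
  then obtain \<alpha> where \<alpha>: "\<alpha> 0 = mat 1" "\<And>t. \<alpha> t \<in> Sp" "(\<alpha> has_vector_derivative A) (at 0)"
    unfolding lie_algebra_def by blast
  \<comment> \<open>Differentiating the invariance of J gives J A + A^T J = 0. For skew
    \<open>A\<close> this says that A commutes with J, a property that the Cayley transform
    preserves.\<close>
  have "((\<lambda>t. transpose (\<alpha> t) ** ?J ** \<alpha> t) has_vector_derivative ?J ** A + transpose A ** ?J) (at 0)"
    using has_vector_derivative_matrix_mult[OF has_vector_derivative_matrix_mult[OF
        bounded_linear.has_vector_derivative[OF bounded_linear_transpose \<alpha>(3)]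
        has_vector_derivative_const[of ?J]] \<alpha>(3)]
    by (simp add: \<alpha>(1))
  moreover have "(\<lambda>t. transpose (\<alpha> t) ** ?J ** \<alpha> t) = (\<lambda>t. ?J)"
    using \<alpha>(2) by (simp add: Sp_iff)
  ultimately have "((\<lambda>t. ?J) has_vector_derivative ?J ** A + transpose A ** ?J) (at (0::real))"
    by simp
  from vector_derivative_unique_at[OF this has_vector_derivative_const]
  have "?J ** A = A ** ?J" by (simp add: skew matrix_mult_linear_simps)
  then have comm: "?J ** ((t/2) *\<^sub>R A) = ((t/2) *\<^sub>R A) ** ?J" for t
    by (simp add: matrix_mult_linear_simps)
  have skt: "transpose ((t/2) *\<^sub>R A) = - ((t/2) *\<^sub>R A)" for t
    by (simp add: skew transpose_scalar)
  show "A \<in> lie_algebra U"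
  proof (rule lie_algebraI[OF _ _ cayley_has_vector_derivative[OF skew]])
    show "cayley ((t/2) *\<^sub>R A) \<in> U" for t
      by (rule orthogonal_commuting_in_U)
        (simp_all add: orthogonal_matrix transpose_cayley_mult_cayley[OF skt] cayley_commute[OF skt comm])
  qed (simp add: cayley_def)
qed

section \<open>The triangular group\<close>

text \<open>The index type carries no order of its own; the ranking \<open>h\<close> provides the
  one that defines triangularity.\<close>

locale index_order =
  fixes h :: "'m::finite \<Rightarrow> nat"
  assumes inj_h: "inj h"
begin

section \<open>Determinants, products and inverses of triangular matrices\<close>

definition upper_triangular :: "real^'m^'m \<Rightarrow> bool" where
  "upper_triangular b \<longleftrightarrow> (\<forall>i j. h j < h i \<longrightarrow> b $ i $ j = 0)"

definition triangular_group :: "(real^'m^'m) set" where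
  "triangular_group = {b. upper_triangular b \<and> (\<forall>i. 0 < b $ i $ i) \<and> det b = 1}"

lemma h_cases: "h i < h j \<or> i = j \<or> h j < h i"
  using inj_h by (meson injD linorder_neqE_nat)

text \<open>Only permutations with h i \<le> h (p i) for all i can contribute. As permuting leaves
  the sum of \<open>h\<close> unchanged, equality holds throughout and p is the identity.\<close>

lemma det_upper_triangular:
  assumes "upper_triangular b"
  shows "det b = (\<Prod>i\<in>UNIV. b $ i $ i)"
proof -
  have zero: "of_int (sign p) * (\<Prod>i\<in>UNIV. b $ i $ p i) = 0"
    if p: "p permutes UNIV" "p \<noteq> id" for p
  proof -
    have "\<exists>i. h (p i) < h i"
    proof (rule ccontr)
      assume "\<nexists>i. h (p i) < h i"
      then have le: "\<And>i. h i \<le> h (p i)" by (auto simp: not_less)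
      have "(\<Sum>i\<in>UNIV. h (p i)) = (\<Sum>i\<in>UNIV. h i)"
        using sum.permute[OF p(1), of h] by (simp add: o_def)
      then have "h (p i) = h i" for i
        using sum_mono_inv[of h UNIV "\<lambda>i. h (p i)" i] le by simp
      then have "p = id" using inj_h by (auto simp: inj_def)
      then show False using p by simp
    qed
    then show ?thesis
      using assms by (auto simp: upper_triangular_def intro!: prod_zero)
  qed
  have "det b = (\<Sum>p\<in>{p. p permutes UNIV}. of_int (sign p) * (\<Prod>i\<in>UNIV. b $ i $ p i))"
    by (simp add: det_def)
  also have "\<dots> = (\<Sum>p\<in>{id}. of_int (sign p) * (\<Prod>i\<in>UNIV. b $ i $ p i))"
  proof (rule sum.mono_neutral_right)
    show "\<forall>p\<in>{p. p permutes UNIV} - {id}. of_int (sign p) * (\<Prod>i\<in>UNIV. b $ i $ p i) = 0"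
      using zero by blast
  qed (auto simp: permutes_id)
  finally show ?thesis by simp
qed

lemma upper_triangular_mult:
  assumes "upper_triangular b" "upper_triangular c"
  shows "upper_triangular (b ** c)" "(b ** c) $ i $ i = b $ i $ i * c $ i $ i"
proof -
  have zero: "b $ i $ k * c $ k $ j = 0" if "h k < h i \<or> h j < h k" for i j k
    using that assms by (auto simp: upper_triangular_def)
  show "upper_triangular (b ** c)"
    unfolding upper_triangular_def
  proof (intro allI impI)
    fix i j assume "h j < h i"
    then have "h k < h i \<or> h j < h k" for k by linarith
    then show "(b ** c) $ i $ j = 0"
      unfolding matrix_matrix_mult_def vec_lambda_beta by (intro sum.neutral ballI zero)
  qed
  have "b $ i $ k * c $ k $ i = (if k = i then b $ i $ i * c $ i $ i else 0)" for k
    using zero[of k i i] h_cases[of k i] by auto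
  then have "(b ** c) $ i $ i = (\<Sum>k\<in>UNIV. if k = i then b $ i $ i * c $ i $ i else 0)"
    unfolding matrix_matrix_mult_def vec_lambda_beta by (intro sum.cong refl)
  then show "(b ** c) $ i $ i = b $ i $ i * c $ i $ i" by simp
qed

text \<open>Take a column \<open>j\<close> of \<open>c\<close> with a nonzero entry below the
  diagonal and the lowest such entry, in row \<open>i\<close>. Then only the term b_ii c_ij survives
  in entry (i, j) of the product, which should be 0.\<close>

lemma upper_triangular_inv:
  assumes b: "upper_triangular b" and d: "\<And>i. b $ i $ i \<noteq> 0" and bc: "b ** c = mat 1"
  shows "upper_triangular c"
proof (rule ccontr)
  assume "\<not> upper_triangular c"
  then obtain i j where ij: "h j < h i" "c $ i $ j \<noteq> 0" by (auto simp: upper_triangular_def)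
  define I where "I = {i. h j < h i \<and> c $ i $ j \<noteq> 0}"
  have "Max (h ` I) \<in> h ` I" using ij by (intro Max_in) (auto simp: I_def)
  then obtain i where i: "i \<in> I" "h i = Max (h ` I)" by force
  then have max: "h k \<le> h i" if "k \<in> I" for k using that by simp
  have "(b ** c) $ i $ j = (\<Sum>k\<in>UNIV. if k = i then b $ i $ i * c $ i $ j else 0)"
    unfolding matrix_matrix_mult_def vec_lambda_beta
  proof (rule sum.cong[OF refl])
    fix k
    consider "h k < h i" | "k = i" | "h i < h k" using h_cases by blast
    then show "b $ i $ k * c $ k $ j = (if k = i then b $ i $ i * c $ i $ j else 0)"
    proof cases
      case 1
      then show ?thesis using b by (auto simp: upper_triangular_def)
    next
      case 3
      then have "k \<notin> I" using max[of k] by auto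
      then have "c $ k $ j = 0" using 3 i(1) by (auto simp: I_def)
      then show ?thesis using 3 by auto
    qed simp
  qed
  then have "(b ** c) $ i $ j \<noteq> 0" using d i by (simp add: I_def)
  moreover have "i \<noteq> j" using i(1) by (auto simp: I_def)
  ultimately show False by (simp add: bc mat_def)
qed

lemma triangular_groupD:
  assumes "b \<in> triangular_group"
  shows "upper_triangular b" "0 < b $ i $ i" "det b = 1" "invertible b" "b \<in> SL"
  using assms by (auto simp: triangular_group_def invertible_det_nz SL_def)

lemma triangular_group_inv:
  assumes "b \<in> triangular_group"
  shows "matrix_inv b \<in> triangular_group" "matrix_inv b $ i $ i = 1 / b $ i $ i"
proof -
  note b = triangular_groupD[OF assms]
  have bc: "b ** matrix_inv b = mat 1" using b(4) by (rule matrix_inv_right)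
  have ut: "upper_triangular (matrix_inv b)"
    using upper_triangular_inv[OF b(1) _ bc] b(2) by (metis less_irrefl)
  have d: "matrix_inv b $ i $ i = 1 / b $ i $ i" for i
    using upper_triangular_mult(2)[OF b(1) ut, of i] b(2)[of i] by (simp add: bc mat_def field_simps)
  show "matrix_inv b $ i $ i = 1 / b $ i $ i" by (rule d)
  show "matrix_inv b \<in> triangular_group"
    using ut b by (simp add: triangular_group_def d det_matrix_inv)
qed

lemma triangular_group_mult:
  "b \<in> triangular_group \<Longrightarrow> c \<in> triangular_group \<Longrightarrow> b ** c \<in> triangular_group"
  by (simp add: triangular_group_def upper_triangular_mult det_mul)

subsection \<open>Triangular representatives of cosets\<close>

text \<open>
  The columns of the rotation are unit vectors \<open>k j\<close> with \<open>g k j\<close> in the span of the first \<open>j\<close>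
  basis vectors and \<open>k j\<close> orthogonal to the preimage of the span of the first \<open>j - 1\<close>.
\<close>

lemma triangular_representative:
  assumes "g \<in> SL"
  obtains b where "b \<in> triangular_group" "left_coset SO b = left_coset SO g"
proof -
  have det_g: "det g = 1" using assms by (simp add: SL_def)
  then have inv_g: "invertible g" by (simp add: invertible_det_nz)
  define V where "V j = {x. \<forall>i. h j < h i \<longrightarrow> (g *v x) $ i = 0}" for j
  define W where "W j = {x. \<forall>i. h j \<le> h i \<longrightarrow> (g *v x) $ i = 0}" for j
  have sub: "subspace (V j)" "subspace (W j)" for j
    by (auto simp: V_def W_def subspace_def matrix_vector_right_distrib matrix_vector_mult_scaleR)
  have "\<exists>x. norm x = 1 \<and> x \<in> V j \<and> (\<forall>y\<in>W j. orthogonal x y) \<and> 0 < (g *v x) $ j" for j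
  proof -
    have e: "g *v (matrix_inv g *v axis j 1) = axis j 1"
      by (simp add: matrix_vector_mul_assoc matrix_inv_right inv_g)
    have "matrix_inv g *v axis j 1 \<in> V j" "matrix_inv g *v axis j 1 \<notin> W j"
      unfolding V_def W_def mem_Collect_eq e by (auto simp: axis_def)
    then have "span (W j) \<subset> span (V j)"
      using sub by (auto simp: span_eq_iff[THEN iffD2] V_def W_def)
    then obtain x where x: "x \<noteq> 0" "x \<in> V j" "\<And>y. y \<in> W j \<Longrightarrow> orthogonal x y"
      using orthogonal_to_subspace_exists_gen[of "W j" "V j"] sub by (metis span_eq_iff)
    \<comment> \<open>\<open>x\<close> is nonzero and orthogonal to \<open>W j\<close>, hence
      outside it; membership in \<open>V j\<close> then leaves only coordinate \<open>j\<close> as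
      the nonzero one.\<close>
    have "x \<notin> W j" using x by (metis orthogonal_self)
    then have nz: "(g *v x) $ j \<noteq> 0"
      using x(2) h_cases unfolding V_def W_def mem_Collect_eq by (metis not_less)
    define s where "s = sgn ((g *v x) $ j) / norm x"
    have "norm (s *\<^sub>R x) = 1" using x(1) nz by (simp add: s_def abs_sgn_eq)
    moreover have "s *\<^sub>R x \<in> V j" using x(2) sub by (simp add: subspace_scale)
    moreover have "orthogonal (s *\<^sub>R x) y" if "y \<in> W j" for y
      using x(3)[OF that] by (simp add: orthogonal_def)
    moreover have "(g *v (s *\<^sub>R x)) $ j = \<bar>(g *v x) $ j\<bar> / norm x"
      by (simp add: s_def matrix_vector_mult_scaleR linordered_idom_class.abs_sgn mult.commute)
    then have "0 < (g *v (s *\<^sub>R x)) $ j" using x(1) nz by simp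
    ultimately show ?thesis by blast
  qed
  then obtain k where k: "\<And>j. norm (k j) = 1" "\<And>j. k j \<in> V j"
      "\<And>j y. y \<in> W j \<Longrightarrow> orthogonal (k j) y" "\<And>j. 0 < (g *v k j) $ j"
    by metis
  define K where "K = (\<chi> i j. k j $ i)"
  have col: "column j K = k j" for j by (simp add: K_def column_def vec_eq_iff)
  have entry: "(g ** K) $ i $ j = (g *v k j) $ i" for i j
    by (simp add: K_def matrix_matrix_mult_def matrix_vector_mult_def)
  have orth: "orthogonal (k i) (k j)" if "h i < h j" for i j
  proof -
    have "k i \<in> W j" using k(2)[of i] that by (auto simp: V_def W_def)
    then show ?thesis using k(3) orthogonal_commute by blast
  qed
  have K: "orthogonal_matrix K"
    unfolding orthogonal_matrix_orthonormal_columns col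
    using k(1) orth h_cases orthogonal_commute by metis
  have ut: "upper_triangular (g ** K)"
    unfolding upper_triangular_def entry using k(2) by (auto simp: V_def)
  \<comment> \<open>Positivity of the diagonal excludes determinant -1, so \<open>K\<close> is a
    rotation and not merely orthogonal.\<close>
  have "0 < det (g ** K)"
    unfolding det_upper_triangular[OF ut] entry using k(4) by (simp add: prod_pos)
  then have det_K: "det K = 1"
    using det_orthogonal_matrix[OF K] det_g by (auto simp: det_mul)
  have "g ** K \<in> triangular_group"
    using ut k(4) det_K det_g by (simp add: triangular_group_def entry det_mul)
  moreover have "left_coset SO (g ** K) = left_coset SO g"
  proof (intro equalityI subsetI)
    fix x assume "x \<in> left_coset SO (g ** K)"
    then obtain l where "l \<in> SO" "x = g ** (K ** l)"
      by (auto simp: left_coset_def matrix_mul_assoc)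
    moreover have "K ** l \<in> SO" if "l \<in> SO" for l
      using that K det_K by (simp add: SO_def rotation_matrix_def orthogonal_matrix_mul det_mul)
    ultimately show "x \<in> left_coset SO g" by (auto simp: left_coset_def)
  next
    fix x assume "x \<in> left_coset SO g"
    then obtain l where l: "l \<in> SO" "x = g ** l" by (auto simp: left_coset_def)
    have "K ** transpose K = mat 1" using K by (simp add: orthogonal_matrix_def)
    then have "x = g ** K ** (transpose K ** l)"
      by (metis l(2) matrix_mul_assoc matrix_mul_lid)
    moreover have "transpose K ** l \<in> SO"
      using l(1) K det_K by (simp add: SO_def rotation_matrix_def orthogonal_matrix_mul det_mul)
    ultimately show "x \<in> left_coset SO (g ** K)" by (auto simp: left_coset_def)
  qed
  ultimately show ?thesis by (rule that)
qed

end

section \<open>Short curves in the triangular group\<close>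

text \<open>
  Since \<open>exp (profile R t) = (1 + R t) (1 + R (1 - t)) / (1 + R)\<close>, partial fractions bound both
  \<open>R exp (- profile R t)\<close> and the derivative of the profile by the same rate, whose integral is
  only logarithmic in \<open>R\<close>.
\<close>

definition profile :: "real \<Rightarrow> real \<Rightarrow> real" where
  "profile R t = ln (1 + R * t) + ln (1 + R * (1 - t)) - ln (1 + R)"

definition profile_deriv :: "real \<Rightarrow> real \<Rightarrow> real" where
  "profile_deriv R t = R / (1 + R * t) - R / (1 + R * (1 - t))"

definition profile_rate :: "real \<Rightarrow> real \<Rightarrow> real" where
  "profile_rate R t = R / (1 + R * t) + R / (1 + R * (1 - t))"

context
  fixes R t :: real
  assumes R: "0 \<le> R" and t: "t \<in> {0..1}"
begin

lemma profile_denominators: "1 \<le> 1 + R * t" "1 \<le> 1 + R * (1 - t)"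
  using R t by simp_all

lemma profile_nonneg: "0 \<le> profile R t"
proof -
  have "1 + R \<le> (1 + R * t) * (1 + R * (1 - t))"
  proof -
    have "(1 + R * t) * (1 + R * (1 - t)) = 1 + R + (R * t) * (R * (1 - t))"
      by (simp add: algebra_simps)
    moreover have "0 \<le> (R * t) * (R * (1 - t))" using R t by simp
    ultimately show ?thesis by linarith
  qed
  then have "ln (1 + R) \<le> ln ((1 + R * t) * (1 + R * (1 - t)))" using R by simp
  also have "\<dots> = ln (1 + R * t) + ln (1 + R * (1 - t))"
    using profile_denominators by (intro ln_mult_pos) auto
  finally show ?thesis by (simp add: profile_def)
qed

lemma profile_has_derivative:
  "(profile R has_real_derivative profile_deriv R t) (at t within {0..1})"
  unfolding profile_def[abs_def] profile_deriv_def
  using profile_denominators by (auto intro!: derivative_eq_intros)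

lemma abs_profile_deriv_le: "\<bar>profile_deriv R t\<bar> \<le> profile_rate R t"
proof -
  have "0 \<le> R / (1 + R * t)" "0 \<le> R / (1 + R * (1 - t))"
    using R profile_denominators by (auto intro!: divide_nonneg_pos)
  then show ?thesis unfolding profile_deriv_def profile_rate_def by linarith
qed

lemma exp_profile_le: "R * exp (- profile R t) \<le> profile_rate R t"
proof -
  define p q where "p = 1 + R * t" and "q = 1 + R * (1 - t)"
  have pq: "1 \<le> p" "1 \<le> q" "p + q = 2 + R"
    using profile_denominators by (auto simp: p_def q_def algebra_simps)
  have rate: "profile_rate R t = R / p + R / q" by (simp only: profile_rate_def p_def q_def)
  have "exp (profile R t) = p * q / (1 + R)"
    using pq R by (simp add: profile_def p_def[symmetric] q_def[symmetric] exp_add exp_diff)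
  then have "R * exp (- profile R t) = R * (1 + R) / (p * q)"
    by (simp add: exp_minus)
  \<comment> \<open>Here 1 + R \<le> p + q = 2 + R; the enlarged fraction splits into the two terms
    of the rate.\<close>
  also have "\<dots> \<le> R * (p + q) / (p * q)"
    using R pq by (intro divide_right_mono mult_left_mono) auto
  also have "\<dots> = profile_rate R t"
    unfolding rate using pq(1,2) by (simp add: field_simps)
  finally show ?thesis .
qed

end

lemma profile_rate_has_integral:
  assumes "0 \<le> R"
  shows "(profile_rate R has_integral 2 * ln (1 + R)) {0..1}"
proof -
  have "(profile_rate R has_integral
      (ln (1 + R * 1) - ln (1 + R * (1 - 1))) - (ln (1 + R * 0) - ln (1 + R * (1 - 0)))) {0..1}"
  proof (rule fundamental_theorem_of_calculus)
    fix t :: real assume t: "t \<in> {0..1}"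
    \<comment> \<open>One antiderivative serves both terms; it runs from - ln (1 + R) to ln (1 +
      R).\<close>
    have "((\<lambda>t. ln (1 + R * t) - ln (1 + R * (1 - t))) has_real_derivative profile_rate R t)
        (at t within {0..1})"
      unfolding profile_rate_def
      using profile_denominators[OF assms t] by (auto intro!: derivative_eq_intros)
    then show "((\<lambda>t. ln (1 + R * t) - ln (1 + R * (1 - t))) has_vector_derivative profile_rate R t)
        (at t within {0..1})"
      by (simp add: has_real_derivative_iff_has_vector_derivative)
  qed simp
  then show ?thesis by simp
qed

context index_order
begin

text \<open>The diagonal direction of the detour. Subtracting the mean rank makes it traceless, so
  determinants stay 1; it drops by at least 1 whenever the rank increases, so following it contracts
  every entry above the diagonal.\<close>

definition height :: "'m \<Rightarrow> real" where
  "height j = (\<Sum>k\<in>UNIV. real (h k)) / CARD('m) - h j"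

lemma sum_height: "(\<Sum>j\<in>UNIV. height j) = 0"
  by (simp add: height_def sum_subtractf)

lemma height_diff: "h i < h j \<Longrightarrow> height j - height i \<le> - 1"
  by (simp add: height_def)

text \<open>
  The curve runs linearly through the unipotent part while the diagonal part first contracts and
  then expands all root directions, which keeps the total length logarithmic.
\<close>

lemma triangular_path_aux:
  fixes b :: "real^'m^'m" and q :: real
  assumes b: "b \<in> triangular_group" and q1: "1 \<le> q"
    and qb: "\<And>i j. \<bar>b $ i $ j\<bar> / b $ j $ j \<le> q" "\<And>i. b $ i $ i \<le> q" "\<And>i. 1 / b $ i $ i \<le> q"
      "\<And>i j. b $ j $ j / b $ i $ i \<le> q"
  defines "R \<equiv> real CARD('m) * fact CARD('m) * q ^ (CARD('m) + 2)"
  defines "H \<equiv> \<Sum>j\<in>UNIV. \<bar>height j\<bar>"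
  shows "\<exists>\<beta> A. \<beta> 0 = mat 1 \<and> \<beta> 1 = b \<and> (\<forall>t\<in>{0..1}. \<beta> t \<in> triangular_group) \<and>
     (\<forall>t\<in>{0..1}. (\<beta> has_vector_derivative \<beta> t ** A t) (at t within {0..1})) \<and>
     continuous_on {0..1} A \<and>
     (\<forall>t\<in>{0..1}. norm (A t) \<le> CARD('m) * CARD('m) * ((1 + H) * profile_rate R t + ln q))"
proof -
  let ?m = "CARD('m)"
  note bD = triangular_groupD[OF b]
  have bpos: "0 < b $ i $ i" for i by (rule bD)
  have bne: "b $ i $ i \<noteq> 0" for i using bpos[of i] by simp
  have R0: "0 \<le> R" using q1 by (simp add: R_def)
  \<comment> \<open>Dividing column j by b_jj factors \<open>b\<close> into the unipotent matrix 1 +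
    N and its diagonal part.\<close>
  define N where "N = (\<chi> i j. if i = j then 0 else b $ i $ j / b $ j $ j)"
  define n where "n t = mat 1 + t *\<^sub>R N" for t :: real
  define e where "e t j = exp (height j * profile R t + t * ln (b $ j $ j))" for t j
  define d where "d t j = height j * profile_deriv R t + ln (b $ j $ j)" for t j
  define \<beta> where "\<beta> t = n t ** diag_matrix (e t)" for t
  \<comment> \<open>The left logarithmic derivative of the unipotent factor; conjugation by the
    diagonal factor multiplies its entry (i, j) by \<open>e t j / e t i\<close>, and
    \<open>d\<close> is the logarithmic derivative of the diagonal factor.\<close>
  define X where "X t = matrix_inv (n t) ** N" for t
  define A where "A t = diag_matrix (\<lambda>j. 1 / e t j) ** X t ** diag_matrix (e t) + diag_matrix (d t)" for t
  have epos: "0 < e t j" for t j by (simp add: e_def)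
  have n_nth: "n t $ i $ j = (if i = j then 1 else t * (b $ i $ j / b $ j $ j))" for t i j
    by (simp add: n_def N_def mat_def)
  have \<beta>_nth: "\<beta> t $ i $ j = n t $ i $ j * e t j" for t i j
    by (simp add: \<beta>_def matrix_mult_diag_nth)
  have n_ut: "upper_triangular (n t)" for t
    using bD(1) unfolding upper_triangular_def n_nth by auto
  have det_n: "det (n t) = 1" for t
    by (simp add: det_upper_triangular[OF n_ut] n_nth)
  then have inv_n: "invertible (n t)" for t by (simp add: invertible_det_nz)
  have ninv_ut: "upper_triangular (matrix_inv (n t))" for t
    by (rule upper_triangular_inv[OF n_ut _ matrix_inv_right[OF inv_n]]) (simp add: n_nth)
  have \<beta>_ut: "upper_triangular (\<beta> t)" for t
    using n_ut[of t] by (simp add: upper_triangular_def \<beta>_nth)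
  have "(\<Prod>i\<in>UNIV. e t i) = 1" for t
  proof -
    have "(\<Sum>j\<in>UNIV. height j * profile R t + t * ln (b $ j $ j)) =
        (\<Sum>j\<in>UNIV. height j) * profile R t + t * (\<Sum>j\<in>UNIV. ln (b $ j $ j))"
      by (simp add: sum.distrib sum_distrib_left sum_distrib_right)
    also have "(\<Sum>j\<in>UNIV. ln (b $ j $ j)) = ln (\<Prod>j\<in>UNIV. b $ j $ j)"
      by (rule ln_prod[symmetric]) (auto simp: bpos bne)
    also have "(\<Prod>j\<in>UNIV. b $ j $ j) = 1" using det_upper_triangular[OF bD(1)] bD(3) by simp
    finally show ?thesis by (simp add: e_def exp_sum[symmetric] sum_height)
  qed
  then have "det (\<beta> t) = 1" for t
    by (simp add: det_upper_triangular[OF \<beta>_ut] \<beta>_nth n_nth)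
  then have \<beta>_mem: "\<beta> t \<in> triangular_group" for t
    using \<beta>_ut epos by (simp add: triangular_group_def \<beta>_nth n_nth)
  \<comment> \<open>The profile vanishes at both ends, so the detour leaves the endpoints
    \<open>mat 1\<close> and \<open>b\<close> in place.\<close>
  have profile_0: "profile R 0 = 0" and profile_1: "profile R 1 = 0"
    by (simp_all add: profile_def)
  have \<beta>0: "\<beta> 0 = mat 1"
    by (simp add: vec_eq_iff \<beta>_nth n_nth e_def profile_0 mat_def)
  have \<beta>1: "\<beta> 1 = b"
    by (simp add: vec_eq_iff \<beta>_nth n_nth e_def profile_1 bne exp_ln[OF bpos])
  have ee: "diag_matrix (e t) ** diag_matrix (\<lambda>j. 1 / e t j) = mat 1" for t
    unfolding vec_eq_iff matrix_mult_diag_nth by (simp add: diag_matrix_def mat_def e_def)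
  have \<beta>A: "\<beta> t ** A t = N ** diag_matrix (e t) + n t ** diag_matrix (e t) ** diag_matrix (d t)" for t
  proof -
    have "\<beta> t ** A t = n t ** (diag_matrix (e t) ** diag_matrix (\<lambda>j. 1 / e t j)) ** X t ** diag_matrix (e t)
        + n t ** diag_matrix (e t) ** diag_matrix (d t)"
      by (simp add: \<beta>_def A_def matrix_add_ldistrib matrix_mul_assoc)
    also have "n t ** (diag_matrix (e t) ** diag_matrix (\<lambda>j. 1 / e t j)) ** X t = N"
      by (simp add: ee X_def matrix_mul_assoc matrix_inv_right[OF inv_n])
    finally show ?thesis .
  qed
  have deriv: "(\<beta> has_vector_derivative \<beta> t ** A t) (at t within {0..1})" if t: "t \<in> {0..1}" for t
  proof (rule has_vector_derivative_matrix_entries)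
    fix i j
    have "((\<lambda>t. e t j) has_real_derivative e t j * d t j) (at t within {0..1})"
      unfolding e_def d_def
      by (auto intro!: derivative_eq_intros profile_has_derivative R0 t simp: mult.commute)
    moreover have "((\<lambda>t. n t $ i $ j) has_real_derivative N $ i $ j) (at t within {0..1})"
      unfolding n_def by (auto intro!: derivative_eq_intros)
    ultimately have "((\<lambda>t. n t $ i $ j * e t j) has_real_derivative
        N $ i $ j * e t j + n t $ i $ j * (e t j * d t j)) (at t within {0..1})"
      by (auto intro!: derivative_eq_intros)
    then show "((\<lambda>t. \<beta> t $ i $ j) has_vector_derivative (\<beta> t ** A t) $ i $ j) (at t within {0..1})"
      by (simp add: \<beta>A \<beta>_nth matrix_mult_diag_nth has_real_derivative_iff_has_vector_derivative mult.assoc)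
  qed
  have cont_e: "continuous_on {0..1} (\<lambda>t. e t j)" for j
  proof -
    have "continuous_on {0..1} (profile R)"
      using profile_has_derivative[OF R0] DERIV_continuous_on by blast
    then show ?thesis unfolding e_def by (intro continuous_intros)
  qed
  have cont_d: "continuous_on {0..1} (\<lambda>t. d t j)" for j
  proof -
    have "continuous_on {0..1} (profile_deriv R)"
      unfolding profile_deriv_def[abs_def] using profile_denominators[OF R0]
      by (intro continuous_intros) (metis not_one_le_zero)+
    then show ?thesis unfolding d_def by (intro continuous_intros)
  qed
  have cont_diag: "continuous_on {0..1} (\<lambda>t. diag_matrix (f t) :: real^'m^'m)"
    if "\<And>j. continuous_on {0..1} (\<lambda>t. f t j)" for f :: "real \<Rightarrow> 'm \<Rightarrow> real"
  proof -
    have "continuous_on {0..1} (\<lambda>t. if i = j then f t j else 0)" for i j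
      using that by (cases "i = j") auto
    then show ?thesis unfolding diag_matrix_def by (intro continuous_intros)
  qed
  have "continuous_on {0..1} n" unfolding n_def by (intro continuous_intros)
  then have "continuous_on {0..1} X"
    unfolding X_def by (intro continuous_on_matrix_mult continuous_on_matrix_inv continuous_intros det_n)
  moreover have "continuous_on {0..1} (\<lambda>t. 1 / e t j)" for j
    using epos by (intro continuous_intros cont_e) (auto simp: less_imp_neq[symmetric])
  ultimately have contA: "continuous_on {0..1} A"
    unfolding A_def by (intro continuous_on_add continuous_on_matrix_mult cont_diag cont_e cont_d)
  have lnb: "\<bar>ln (b $ j $ j)\<bar> \<le> ln q" for j
  proof -
    have "ln (b $ j $ j) \<le> ln q" using qb(2) bpos q1 by simp
    moreover have "ln (1 / b $ j $ j) \<le> ln q" using qb(3) bpos q1 by (subst ln_le_cancel_iff) auto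
    ultimately show ?thesis by (simp add: ln_div bne)
  qed
  have Nq: "\<bar>N $ i $ j\<bar> \<le> q" for i j
    using qb(1)[of i j] q1 bpos[of j] by (simp add: N_def)
  have X_zero: "X t $ i $ j = 0" if "\<not> h i < h j" for t i j
  proof -
    have "matrix_inv (n t) $ i $ k * N $ k $ j = 0" for k
    proof (cases "h k < h i")
      case True
      then show ?thesis using ninv_ut[of t] by (simp add: upper_triangular_def)
    next
      case False
      then have "N $ k $ j = 0" using that bD(1) h_cases[of k j] by (auto simp: N_def upper_triangular_def)
      then show ?thesis by simp
    qed
    then show ?thesis
      unfolding X_def matrix_matrix_mult_def vec_lambda_beta by (intro sum.neutral ballI)
  qed
  have X_bound: "\<bar>X t $ i $ j\<bar> \<le> ?m * (fact ?m * q ^ ?m * q)" if t: "t \<in> {0..1}" for t i j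
  proof -
    have "\<bar>n t $ i $ j\<bar> \<le> q" for i j
    proof (cases "i = j")
      case False
      have "\<bar>t * N $ i $ j\<bar> \<le> 1 * q"
        unfolding abs_mult using t Nq q1 by (intro mult_mono) auto
      then show ?thesis using False by (simp add: n_nth N_def)
    qed (simp add: n_nth q1)
    then have ninv: "\<bar>matrix_inv (n t) $ i $ k\<bar> \<le> fact ?m * q ^ ?m" for k
      by (intro inverse_entry_bound det_n q1)
    have "\<bar>X t $ i $ j\<bar> \<le> (\<Sum>k\<in>UNIV. \<bar>matrix_inv (n t) $ i $ k * N $ k $ j\<bar>)"
      unfolding X_def matrix_matrix_mult_def by simp
    also have "\<dots> \<le> (\<Sum>k\<in>(UNIV::'m set). fact ?m * q ^ ?m * q)"
      unfolding abs_mult using q1 by (intro sum_mono mult_mono ninv Nq) auto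
    finally show ?thesis by simp
  qed
  have A_bound: "\<bar>A t $ i $ j\<bar> \<le> (1 + H) * profile_rate R t + ln q" if t: "t \<in> {0..1}" for t i j
  proof -
    have A_nth: "A t $ i $ j = X t $ i $ j * (e t j / e t i) + (if i = j then d t j else 0)"
      by (simp add: A_def matrix_mult_diag_nth diag_mult_matrix_nth) (simp add: diag_matrix_def)
    have rate0: "0 \<le> profile_rate R t" using abs_profile_deriv_le[OF R0 t] by linarith
    have first: "\<bar>X t $ i $ j * (e t j / e t i)\<bar> \<le> profile_rate R t"
    proof (cases "h i < h j")
      case False
      then show ?thesis using X_zero rate0 by simp
    next
      case True
      have "ln (b $ j $ j / b $ i $ i) \<le> ln q"
        using bpos q1 qb(4)[of j i] by (subst ln_le_cancel_iff) auto
      then have "ln (b $ j $ j) - ln (b $ i $ i) \<le> ln q"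
        by (simp add: ln_div bne)
      then have "t * (ln (b $ j $ j) - ln (b $ i $ i)) \<le> t * ln q"
        using t by (intro mult_left_mono) auto
      also have "\<dots> \<le> 1 * ln q" using t q1 by (intro mult_right_mono) auto
      finally have 1: "t * (ln (b $ j $ j) - ln (b $ i $ i)) \<le> ln q" by simp
      have "(height j - height i) * profile R t \<le> (- 1) * profile R t"
        by (intro mult_right_mono height_diff True profile_nonneg R0 t)
      with 1 have "(height j * profile R t + t * ln (b $ j $ j)) - (height i * profile R t + t * ln (b $ i $ i))
          \<le> ln q - profile R t"
        by (simp add: algebra_simps)
      then have "e t j / e t i \<le> exp (ln q - profile R t)"
        unfolding e_def exp_diff[symmetric] by (simp only: exp_le_cancel_iff)
      also have "\<dots> = q * exp (- profile R t)" using q1 by (simp add: exp_diff exp_minus field_simps)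
      finally have "\<bar>e t j / e t i\<bar> \<le> q * exp (- profile R t)"
        using epos by (simp add: less_imp_le)
      then have "\<bar>X t $ i $ j * (e t j / e t i)\<bar> \<le> (?m * (fact ?m * q ^ ?m * q)) * (q * exp (- profile R t))"
        unfolding abs_mult[of "X t $ i $ j"] using q1 by (intro mult_mono X_bound t) auto
      \<comment> \<open>\<open>R\<close> was chosen as this product: \<open>X\<close> contributes q
        to the power CARD('m) + 1, and one more q bounds the ratio of diagonal entries of
        \<open>b\<close>.\<close>
      also have "\<dots> = R * exp (- profile R t)" by (simp add: R_def power_add power2_eq_square)
      also have "\<dots> \<le> profile_rate R t" by (rule exp_profile_le[OF R0 t])
      finally show ?thesis .
    qed
    have "\<bar>height j\<bar> \<le> H" unfolding H_def by (rule member_le_sum) auto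
    then have "\<bar>height j * profile_deriv R t\<bar> \<le> H * profile_rate R t"
      unfolding abs_mult using abs_profile_deriv_le[OF R0 t] by (intro mult_mono) (auto simp: H_def sum_nonneg)
    then have second: "\<bar>d t j\<bar> \<le> H * profile_rate R t + ln q"
      unfolding d_def using lnb[of j] by linarith
    have "0 \<le> H * profile_rate R t + ln q"
      using second by linarith
    then have "\<bar>if i = j then d t j else 0\<bar> \<le> H * profile_rate R t + ln q"
      using second by simp
    moreover have "\<bar>A t $ i $ j\<bar> \<le> \<bar>X t $ i $ j * (e t j / e t i)\<bar> + \<bar>if i = j then d t j else 0\<bar>"
      unfolding A_nth by (rule abs_triangle_ineq)
    ultimately show ?thesis unfolding distrib_right mult_1_left using first by linarith
  qed
  show ?thesis
    by (intro exI[of _ \<beta>] exI[of _ A] conjI ballI \<beta>0 \<beta>1 \<beta>_mem deriv contA norm_matrix_le_const A_bound)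
qed

text \<open>The parameters \<open>q\<close> and \<open>R\<close> of the previous lemma can be taken
  polynomial in \<open>norm b\<close>, so their logarithms are linear in
  \<open>ln (1 + norm b)\<close>.\<close>

lemma triangular_path:
  obtains C where "0 \<le> C"
    "\<And>b. b \<in> triangular_group \<Longrightarrow> \<exists>\<beta> A v I. \<beta> 0 = mat 1 \<and> \<beta> 1 = b \<and>
       (\<forall>t\<in>{0..1}. \<beta> t \<in> triangular_group) \<and>
       (\<forall>t\<in>{0..1}. (\<beta> has_vector_derivative \<beta> t ** A t) (at t within {0..1})) \<and>
       continuous_on {0..1} A \<and> (\<forall>t\<in>{0..1}. norm (A t) \<le> v t) \<and>
       (v has_integral I) {0..1} \<and> I \<le> C * (1 + ln (1 + norm b))"
proof -
  let ?m = "CARD('m)"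
  define H where "H = (\<Sum>j\<in>UNIV. \<bar>height j\<bar>)"
  define f where "f = (fact ?m :: real)"
  \<comment> \<open>Chosen so that ln (1 + R) \<le> a * (1 + l), using 1 + R \<le> 2 R and the
    definitions of \<open>R\<close> and \<open>q\<close> below.\<close>
  define a where "a = ln 2 + ln (?m * f) + (?m + 2) * (ln f + (?m + 1))"
  define C where "C = ?m * ?m * ((1 + H) * (2 * a) + (ln f + (?m + 1)))"
  have f1: "1 \<le> f" by (simp add: f_def)
  have m1: "1 \<le> real ?m" by (simp add: Suc_leI)
  have H0: "0 \<le> H" by (simp add: H_def sum_nonneg)
  have mf: "1 \<le> ?m * f" using mult_mono[OF m1 f1] by simp
  have a0: "0 \<le> a" unfolding a_def using mf f1 by (intro add_nonneg_nonneg mult_nonneg_nonneg) auto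
  have C0: "0 \<le> C" unfolding C_def using H0 a0 f1
    by (intro add_nonneg_nonneg mult_nonneg_nonneg) auto
  show ?thesis
  proof (rule that[OF C0])
    fix b assume b: "b \<in> triangular_group"
    note bD = triangular_groupD[OF b]
    define x where "x = 1 + norm b"
    define l where "l = ln x"
    \<comment> \<open>Reciprocals of diagonal entries are at most f * x ^ ?m by
      \<open>inverse_entry_bound\<close>; one more factor x allows multiplication by an entry of
      \<open>b\<close>.\<close>
    define q where "q = f * x ^ (?m + 1)"
    define R where "R = ?m * f * q ^ (?m + 2)"
    have x1: "1 \<le> x" by (simp add: x_def)
    then have l0: "0 \<le> l" by (simp add: l_def)
    have "1 * 1 \<le> f * x ^ (?m + 1)"
      using f1 by (intro mult_mono one_le_power x1) auto
    then have q1: "1 \<le> q" unfolding q_def by (simp only: mult_1_left)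
    have bx: "\<bar>b $ i $ j\<bar> \<le> x" for i j using abs_entry_le_norm[of b i j] by (simp add: x_def)
    have cx: "1 / b $ i $ i \<le> f * x ^ ?m" for i
      using inverse_entry_bound[OF bD(3) bx x1, of i i] triangular_group_inv(2)[OF b, of i]
        bD(2)[of i]
      by (simp add: f_def)
    have prod: "\<bar>b $ i $ j\<bar> * (1 / b $ k $ k) \<le> q" for i j k
    proof -
      have "\<bar>b $ i $ j\<bar> * (1 / b $ k $ k) \<le> x * (f * x ^ ?m)"
        using bx[of i j] cx[of k] x1 bD(2)[of k] by (intro mult_mono) auto
      then show ?thesis by (simp add: q_def algebra_simps)
    qed
    have qb1: "\<bar>b $ i $ j\<bar> / b $ j $ j \<le> q" for i j using prod[of i j j] by simp
    have qb2: "b $ i $ i \<le> q" for i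
    proof -
      have "1 * x \<le> (f * x ^ ?m) * x"
        using mult_mono[OF f1 one_le_power[OF x1, of ?m]] f1 x1 by (intro mult_right_mono) auto
      then show ?thesis using bx[of i i] by (simp add: q_def algebra_simps)
    qed
    have qb3: "1 / b $ i $ i \<le> q" for i
    proof -
      have "f * x ^ ?m * 1 \<le> f * x ^ ?m * x" using f1 x1 by (intro mult_left_mono) auto
      then show ?thesis using cx[of i] by (simp add: q_def algebra_simps)
    qed
    have qb4: "b $ j $ j / b $ i $ i \<le> q" for i j
      using prod[of j j i] bD(2)[of j] by simp
    obtain \<beta> A where \<beta>: "\<beta> 0 = mat 1" "\<beta> 1 = b" "\<forall>t\<in>{0..1}. \<beta> t \<in> triangular_group"
      "\<forall>t\<in>{0..1}. (\<beta> has_vector_derivative \<beta> t ** A t) (at t within {0..1})"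
      "continuous_on {0..1} A"
      "\<forall>t\<in>{0..1}. norm (A t) \<le> ?m * ?m * ((1 + H) * profile_rate R t + ln q)"
      using triangular_path_aux[OF b q1 qb1 qb2 qb3 qb4] unfolding R_def H_def f_def by blast
    have qm: "1 \<le> q ^ (?m + 2)" using q1 by (rule one_le_power)
    have R1: "1 \<le> R" unfolding R_def using mult_mono[OF mf qm] mf by simp
    define I where "I = ?m * ?m * ((1 + H) * (2 * ln (1 + R)) + ln q)"
    have int: "((\<lambda>t. ?m * ?m * ((1 + H) * profile_rate R t + ln q)) has_integral I) {0..1}"
    proof -
      have "((\<lambda>t::real. ln q) has_integral ln q) {0..1}"
        using has_integral_const_real[of "ln q" 0 1] by simp
      then show ?thesis
        unfolding I_def using R1
        by (intro has_integral_mult_right has_integral_add profile_rate_has_integral) auto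
    qed
    have "I \<le> C * (1 + l)"
    proof -
      have "ln q = ln f + (?m + 1) * l"
        using f1 x1 by (simp add: q_def l_def ln_mult ln_realpow algebra_simps)
      also have "\<dots> \<le> (ln f + (?m + 1)) * (1 + l)"
        using f1 l0 by (simp add: algebra_simps)
      finally have lq: "ln q \<le> (ln f + (?m + 1)) * (1 + l)" .
      have "ln (1 + R) \<le> ln (2 * R)" using R1 by simp
      also have "\<dots> = ln 2 + ln (?m * f) + (?m + 2) * ln q"
      proof -
        have "ln R = ln (?m * f) + ln (q ^ (?m + 2))"
          unfolding R_def using mf qm by (intro ln_mult_pos) linarith+
        moreover have "ln (q ^ (?m + 2)) = (?m + 2) * ln q" using q1 by (subst ln_realpow) auto
        ultimately show ?thesis using R1 by (simp add: ln_mult)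
      qed
      also have "\<dots> \<le> (ln 2 + ln (?m * f)) * (1 + l) + (?m + 2) * ((ln f + (?m + 1)) * (1 + l))"
      proof (intro add_mono mult_left_mono lq)
        have "0 \<le> (ln 2 + ln (?m * f)) * l" using mf l0 by (intro mult_nonneg_nonneg add_nonneg_nonneg) auto
        then show "ln 2 + ln (?m * f) \<le> (ln 2 + ln (?m * f)) * (1 + l)" by (simp only: distrib_left mult_1_right)
      qed simp
      also have "\<dots> = a * (1 + l)" by (simp add: a_def algebra_simps)
      finally have lR: "ln (1 + R) \<le> a * (1 + l)" .
      have "I \<le> ?m * ?m * ((1 + H) * (2 * (a * (1 + l))) + (ln f + (?m + 1)) * (1 + l))"
        unfolding I_def using H0 by (intro mult_left_mono add_mono lR lq) auto
      then show ?thesis by (simp add: C_def algebra_simps)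
    qed
    then show "\<exists>\<beta> A v I. \<beta> 0 = mat 1 \<and> \<beta> 1 = b \<and> (\<forall>t\<in>{0..1}. \<beta> t \<in> triangular_group) \<and>
       (\<forall>t\<in>{0..1}. (\<beta> has_vector_derivative \<beta> t ** A t) (at t within {0..1})) \<and>
       continuous_on {0..1} A \<and> (\<forall>t\<in>{0..1}. norm (A t) \<le> v t) \<and>
       (v has_integral I) {0..1} \<and> I \<le> C * (1 + ln (1 + norm b))"
      unfolding l_def x_def
      by (intro exI[of _ \<beta>] exI[of _ A] exI[of _ I]
          exI[of _ "\<lambda>t. ?m * ?m * ((1 + H) * profile_rate R t + ln q)"] conjI \<beta> int)
  qed
qed

end

section \<open>The embedding of the triangular group into the symplectic group\<close>

lemma has_vector_derivative_block_matrix: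
  assumes "(a has_vector_derivative a') F" "(b has_vector_derivative b') F"
    "(c has_vector_derivative c') F" "(d has_vector_derivative d') F" and F: "F = at x within S"
  shows "((\<lambda>t. block_matrix (a t) (b t) (c t) (d t)) has_vector_derivative block_matrix a' b' c' d') F"
proof -
  note * = assms(1-4)[unfolded F, THEN has_vector_derivative_entry,
      unfolded has_real_derivative_iff_has_vector_derivative]
  show ?thesis
    unfolding F
  proof (rule has_vector_derivative_matrix_entries)
    fix p q :: "'a + 'a"
    show "((\<lambda>t. block_matrix (a t) (b t) (c t) (d t) $ p $ q) has_vector_derivative
        block_matrix a' b' c' d' $ p $ q) (at x within S)"
      by (cases p; cases q) (simp_all add: *)
  qed
qed

text \<open>\<open>p\<close> is the last index and \<open>\<iota> o\<^sub>n\<close> the first, so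
  row \<open>p\<close> and column \<open>\<iota> o\<^sub>n\<close> of a triangular matrix vanish off
  the diagonal. The former makes \<open>sub\<close> multiplicative, the latter makes the first basis
  vector an eigenvector.\<close>

locale symplectic_embedding = index_order h
  for h :: "'m::finite \<Rightarrow> nat" +
  fixes \<iota> :: "'n::finite \<Rightarrow> 'm" and p :: 'm and o\<^sub>n :: 'n
  assumes inj_\<iota>: "inj \<iota>" and range_\<iota>: "range \<iota> = - {p}"
    and p_max: "i \<noteq> p \<Longrightarrow> h i < h p" and o_min: "i \<noteq> \<iota> o\<^sub>n \<Longrightarrow> h (\<iota> o\<^sub>n) < h i"
begin

lemma \<iota>_neq_p: "\<iota> i \<noteq> p"
  using range_\<iota> by auto

lemma \<iota>_eq_iff: "\<iota> i = \<iota> j \<longleftrightarrow> i = j"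
  using inj_\<iota> by (auto simp: inj_def)

lemma sum_\<iota>: "(\<Sum>k\<in>UNIV. f k) = (\<Sum>k\<in>UNIV. f (\<iota> k)) + (f p :: real)"
proof -
  have "(\<Sum>k\<in>UNIV. f k) = sum f (range \<iota>) + f p"
    using sum.remove[of UNIV p f] by (simp add: range_\<iota> Compl_eq_Diff_UNIV add.commute)
  then show ?thesis by (simp add: sum.reindex[OF inj_\<iota>])
qed

definition sub :: "real^'m^'m \<Rightarrow> real^'n^'n" where
  "sub b = (\<chi> i j. b $ \<iota> i $ \<iota> j)"

definition scale :: "real^'m^'m \<Rightarrow> real" where
  "scale b = sqrt (1 / (b $ p $ p * b $ \<iota> o\<^sub>n $ \<iota> o\<^sub>n))"

definition lin :: "real^'m^'m \<Rightarrow> real^'n^'n" where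
  "lin b = scale b *\<^sub>R sub b"

text \<open>The inverse transpose of \<open>lin b\<close>, by \<open>lin_dual\<close>. Inverting
  before applying \<open>lin\<close> lets multiplicativity and derivative follow from those of
  \<open>lin\<close>.\<close>

definition dual :: "real^'m^'m \<Rightarrow> real^'n^'n" where
  "dual b = transpose (lin (matrix_inv b))"

definition shear :: "('n \<Rightarrow> real) \<Rightarrow> real^'n^'n" where
  "shear w = (\<chi> i j. (if i = o\<^sub>n then w j else 0) + (if j = o\<^sub>n then w i else 0))"

definition last_column :: "real^'m^'m \<Rightarrow> 'n \<Rightarrow> real" where
  "last_column b i = b $ \<iota> i $ p / b $ p $ p"

text \<open>
  In the maximal parabolic of \<open>Sp\<close> with abelian unipotent radical \<open>Sym\<^sup>2\<close>, the vectors \<open>e\<^sub>o w\<close> form a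
  submodule of \<open>Sym\<^sup>2\<close> under triangular matrices, isomorphic to the standard module up to a
  character; the factor \<^const>\<open>scale\<close> matches that character with the one of \<open>SL\<close>.
\<close>

definition embedding :: "real^'m^'m \<Rightarrow> real^('n + 'n)^('n + 'n)" where
  "embedding b = block_matrix (lin b) (shear (last_column b) ** dual b) 0 (dual b)"

section \<open>Multiplicativity of the embedding and its image in Sp\<close>

lemma last_row_zero:
  assumes "b \<in> triangular_group"
  shows "b $ p $ \<iota> i = 0"
  using triangular_groupD(1)[OF assms] p_max[OF \<iota>_neq_p] by (simp add: upper_triangular_def)

lemma first_column_zero:
  assumes "b \<in> triangular_group" "i \<noteq> o\<^sub>n"
  shows "b $ \<iota> i $ \<iota> o\<^sub>n = 0"
  using triangular_groupD(1)[OF assms(1)] o_min[of "\<iota> i"] assms(2)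
  by (simp add: upper_triangular_def \<iota>_eq_iff)

lemma scale_pos: "b \<in> triangular_group \<Longrightarrow> 0 < scale b"
  by (simp add: triangular_groupD scale_def)

lemma scale_square:
  assumes "b \<in> triangular_group"
  shows "scale b * scale b = 1 / (b $ p $ p * b $ \<iota> o\<^sub>n $ \<iota> o\<^sub>n)"
proof -
  have "0 \<le> 1 / (b $ p $ p * b $ \<iota> o\<^sub>n $ \<iota> o\<^sub>n)"
    using triangular_groupD(2)[OF assms] by (simp add: less_imp_le)
  then show ?thesis unfolding scale_def by (simp only: real_sqrt_mult_self abs_of_nonneg)
qed

lemma sub_mult:
  assumes "b \<in> triangular_group"
  shows "sub (a ** b) = sub a ** sub b"
  by (simp add: vec_eq_iff sub_def matrix_matrix_mult_def sum_\<iota> last_row_zero[OF assms])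

lemma scale_mult:
  assumes "a \<in> triangular_group" "b \<in> triangular_group"
  shows "scale (a ** b) = scale a * scale b"
  using upper_triangular_mult(2)[OF triangular_groupD(1)[OF assms(1)] triangular_groupD(1)[OF assms(2)]]
  by (simp add: scale_def real_sqrt_mult real_sqrt_divide mult_ac)

lemma lin_mult:
  assumes "a \<in> triangular_group" "b \<in> triangular_group"
  shows "lin (a ** b) = lin a ** lin b"
  by (simp add: lin_def scale_mult[OF assms] sub_mult[OF assms(2)] matrix_mult_linear_simps)

lemma lin_one: "lin (mat 1) = mat 1"
  by (simp add: vec_eq_iff lin_def scale_def sub_def mat_def \<iota>_eq_iff)

lemma dual_mult:
  assumes "a \<in> triangular_group" "b \<in> triangular_group"
  shows "dual (a ** b) = dual a ** dual b"
  using assms by (simp add: dual_def matrix_inv_mult triangular_groupD lin_mult triangular_group_inv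
      matrix_transpose_mul)

lemma lin_dual:
  assumes "b \<in> triangular_group"
  shows "transpose (lin b) ** dual b = mat 1" "transpose (dual b) ** lin b = mat 1"
    "dual b ** transpose (lin b) = mat 1"
proof -
  note inv = triangular_group_inv(1)[OF assms] triangular_groupD(4)[OF assms]
  have "lin (matrix_inv b) ** lin b = mat 1"
    using lin_mult[OF inv(1) assms] by (simp add: matrix_inv_left inv lin_one)
  then show *: "transpose (dual b) ** lin b = mat 1" by (simp add: dual_def)
  then have "transpose (transpose (dual b) ** lin b) = mat 1" by simp
  then show "transpose (lin b) ** dual b = mat 1" by (simp add: matrix_transpose_mul)
  then show "dual b ** transpose (lin b) = mat 1" using matrix_left_right_inverse by blast
qed

text \<open>The first basis vector is an eigenvector of \<open>lin a\<close>, so e w^T + w e^T keeps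
  its shape. The eigenvalue, times the other factor \<open>scale a\<close>, is 1 / a_pp; this is
  what determines the scale.\<close>

lemma shear_conjugate:
  assumes a: "a \<in> triangular_group"
  shows "lin a ** shear w ** transpose (lin a) = shear (\<lambda>i. (\<Sum>k\<in>UNIV. a $ \<iota> i $ \<iota> k * w k) / a $ p $ p)"
proof -
  have "(lin a ** shear w ** transpose (lin a)) $ i $ j =
      shear (\<lambda>i. (\<Sum>k\<in>UNIV. a $ \<iota> i $ \<iota> k * w k) / a $ p $ p) $ i $ j" for i j
  proof -
    let ?s = "scale a" and ?a = "\<lambda>i k. a $ \<iota> i $ \<iota> k"
    have "(lin a ** shear w) $ i $ l = ?s * (?a i o\<^sub>n * w l + (if l = o\<^sub>n then \<Sum>k\<in>UNIV. ?a i k * w k else 0))" for l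
      by (simp add: matrix_matrix_mult_def lin_def sub_def shear_def distrib_left sum.distrib
          if_distrib[of "\<lambda>c. _ * c"] sum_distrib_left mult.assoc cong: if_cong)
    then have "(lin a ** shear w ** transpose (lin a)) $ i $ j =
        (\<Sum>l\<in>UNIV. ?s * (?a i o\<^sub>n * w l + (if l = o\<^sub>n then \<Sum>k\<in>UNIV. ?a i k * w k else 0)) * (?s * ?a j l))"
      unfolding matrix_matrix_mult_def[of "lin a ** shear w"] by (simp add: transpose_def lin_def sub_def)
    also have "\<dots> = (?s * ?s) * (?a i o\<^sub>n * (\<Sum>l\<in>UNIV. ?a j l * w l) + ?a j o\<^sub>n * (\<Sum>k\<in>UNIV. ?a i k * w k))"
      by (simp add: distrib_left distrib_right sum.distrib if_distrib[of "\<lambda>c. _ * c"] if_distrib[of "\<lambda>c. c * _"]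
          sum_distrib_left sum_distrib_right mult_ac cong: if_cong)
    also have "\<dots> = shear (\<lambda>i. (\<Sum>k\<in>UNIV. ?a i k * w k) / a $ p $ p) $ i $ j"
    proof -
      have "?s * ?s * ?a i o\<^sub>n = (if i = o\<^sub>n then 1 / a $ p $ p else 0)" for i
        using triangular_groupD(2)[OF a, of "\<iota> o\<^sub>n"]
        by (simp add: scale_square[OF a] first_column_zero[OF a])
      then show ?thesis
        unfolding distrib_left mult.assoc[symmetric] by (simp add: shear_def)
    qed
    finally show ?thesis .
  qed
  then show ?thesis by (simp add: vec_eq_iff)
qed

lemma shear_add: "shear (\<lambda>i. v i + w i) = shear v + shear w"
  by (simp add: shear_def vec_eq_iff)

text \<open>The normalized last column is a cocycle for exactly the action on w found in
  \<open>shear_conjugate\<close>.\<close>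

lemma last_column_mult:
  assumes a: "a \<in> triangular_group" and b: "b \<in> triangular_group"
  shows "last_column (a ** b) =
    (\<lambda>i. last_column a i + (\<Sum>k\<in>UNIV. a $ \<iota> i $ \<iota> k * last_column b k) / a $ p $ p)"
proof
  fix i
  have pos: "a $ p $ p \<noteq> 0" "b $ p $ p \<noteq> 0"
    using triangular_groupD(2)[OF a, of p] triangular_groupD(2)[OF b, of p] by auto
  have "(a ** b) $ p $ p = a $ p $ p * b $ p $ p"
    using a b by (simp add: upper_triangular_mult triangular_groupD)
  then show "last_column (a ** b) i = last_column a i + (\<Sum>k\<in>UNIV. a $ \<iota> i $ \<iota> k * last_column b k) / a $ p $ p"
    using pos by (simp add: last_column_def matrix_matrix_mult_def sum_\<iota> field_simps flip: sum_divide_distrib)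
qed

lemma embedding_mult:
  assumes a: "a \<in> triangular_group" and b: "b \<in> triangular_group"
  shows "embedding (a ** b) = embedding a ** embedding b"
proof -
  let ?S = "\<lambda>x. shear (last_column x)"
  have "?S (a ** b) = ?S a + lin a ** ?S b ** transpose (lin a)"
    by (simp add: last_column_mult[OF a b] shear_add shear_conjugate[OF a])
  \<comment> \<open>Cancelling \<open>transpose (lin a) ** dual a\<close>, which is the identity,
    leaves the upper right block of the product.\<close>
  then have "?S (a ** b) ** dual (a ** b) =
      ?S a ** dual a ** dual b + lin a ** ?S b ** (transpose (lin a) ** dual a) ** dual b"
    by (simp add: dual_mult[OF a b] matrix_mult_linear_simps matrix_mul_assoc)
  also have "\<dots> = lin a ** (?S b ** dual b) + ?S a ** dual a ** dual b"
    by (simp add: lin_dual[OF a] matrix_mul_assoc add.commute)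
  finally show ?thesis
    by (simp add: embedding_def block_matrix_mult lin_mult[OF a b] dual_mult[OF a b])
qed

lemma transpose_shear: "transpose (shear w) = shear w"
  by (simp add: shear_def transpose_def vec_eq_iff add.commute)

lemma embedding_in_Sp:
  assumes b: "b \<in> triangular_group"
  shows "embedding b \<in> Sp"
proof -
  have "transpose (dual b) ** (shear (last_column b) ** dual b) =
      transpose (dual b) ** shear (last_column b) ** dual b"
    by (rule matrix_mul_assoc)
  moreover have "transpose 0 = (0 :: real^'n^'n)" by (simp add: transpose_def vec_eq_iff)
  ultimately show ?thesis
    unfolding Sp_iff embedding_def symplectic_unit_def transpose_block_matrix block_matrix_mult block_matrix_eq_iff
    by (simp add: matrix_mult_linear_simps lin_dual[OF b] matrix_transpose_mul transpose_shear)
qed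

lemma embedding_one: "embedding (mat 1) = mat 1"
proof -
  have "dual (mat 1) = mat 1" by (simp add: dual_def lin_one)
  moreover have "shear (last_column (mat 1)) = 0"
    by (simp add: shear_def last_column_def vec_eq_iff mat_def \<iota>_neq_p)
  ultimately show ?thesis
    by (simp add: embedding_def lin_one block_matrix_mat_1)
qed

subsection \<open>The derivative of the embedding\<close>

text \<open>The scalar term comes from differentiating \<open>scale\<close>, an inverse square root
  of two diagonal entries, at the identity.\<close>

definition dlin :: "real^'m^'m \<Rightarrow> real^'n^'n" where
  "dlin A = sub A - ((A $ p $ p + A $ \<iota> o\<^sub>n $ \<iota> o\<^sub>n) / 2) *\<^sub>R mat 1"

definition dembedding :: "real^'m^'m \<Rightarrow> real^('n + 'n)^('n + 'n)" where
  "dembedding A = block_matrix (dlin A) (shear (\<lambda>i. A $ \<iota> i $ p)) 0 (- transpose (dlin A))"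

lemma bounded_linear_dembedding: "bounded_linear dembedding"
  unfolding linear_conv_bounded_linear[symmetric]
  by (rule linearI; simp add: sum_matrix_eq_iff dembedding_def dlin_def sub_def shear_def transpose_def mat_def
      add_divide_distrib algebra_simps)

lemma dlin_minus: "dlin (- A) = - dlin A"
  by (simp add: dlin_def sub_def vec_eq_iff mat_def diff_divide_distrib add_divide_distrib)

lemma lin_has_vector_derivative:
  fixes x :: "real \<Rightarrow> real^'m^'m"
  assumes "(x has_vector_derivative X) (at t within S)" "x t = mat 1"
  shows "((\<lambda>s. lin (x s)) has_vector_derivative dlin X) (at t within S)"
proof (rule has_vector_derivative_matrix_entries)
  fix i j
  note d = has_vector_derivative_entry[OF assms(1)]
  define u where "u s = x s $ p $ p * x s $ \<iota> o\<^sub>n $ \<iota> o\<^sub>n" for s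
  have u1: "u t = 1" by (simp add: u_def assms(2) mat_def)
  have "(u has_real_derivative X $ p $ p + X $ \<iota> o\<^sub>n $ \<iota> o\<^sub>n) (at t within S)"
    using DERIV_mult[OF d d, of p p "\<iota> o\<^sub>n" "\<iota> o\<^sub>n"]
    by (simp add: u_def[abs_def] assms(2) mat_def add.commute)
  then have "((\<lambda>s. sqrt (1 / u s)) has_real_derivative - (X $ p $ p + X $ \<iota> o\<^sub>n $ \<iota> o\<^sub>n) / 2) (at t within S)"
    by (auto intro!: derivative_eq_intros simp: u1)
  then have "((\<lambda>s. scale (x s)) has_real_derivative - (X $ p $ p + X $ \<iota> o\<^sub>n $ \<iota> o\<^sub>n) / 2) (at t within S)"
    by (simp only: scale_def u_def)
  from DERIV_mult[OF this d[of "\<iota> i" "\<iota> j"]]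
  have "((\<lambda>s. scale (x s) * x s $ \<iota> i $ \<iota> j) has_real_derivative dlin X $ i $ j) (at t within S)"
  proof (rule DERIV_cong)
    show "- (X $ p $ p + X $ \<iota> o\<^sub>n $ \<iota> o\<^sub>n) / 2 * x t $ \<iota> i $ \<iota> j + X $ \<iota> i $ \<iota> j * scale (x t) = dlin X $ i $ j"
      by (simp add: assms(2) mat_def dlin_def sub_def scale_def \<iota>_eq_iff add_divide_distrib)
  qed
  then show "((\<lambda>s. lin (x s) $ i $ j) has_vector_derivative dlin X $ i $ j) (at t within S)"
    by (simp add: lin_def sub_def has_real_derivative_iff_has_vector_derivative)
qed

lemma last_column_has_derivative:
  fixes x :: "real \<Rightarrow> real^'m^'m"
  assumes "(x has_vector_derivative X) (at t within S)" "x t = mat 1"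
  shows "((\<lambda>s. last_column (x s) i) has_real_derivative X $ \<iota> i $ p) (at t within S)"
proof -
  note d = has_vector_derivative_entry[OF assms(1)]
  have "x t $ p $ p \<noteq> 0" by (simp add: assms(2) mat_def)
  from DERIV_divide[OF d[of "\<iota> i" p] d[of p p] this]
  show ?thesis by (simp add: last_column_def assms(2) mat_def \<iota>_neq_p)
qed

lemma embedding_has_vector_derivative_at_one:
  fixes x :: "real \<Rightarrow> real^'m^'m"
  assumes x: "(x has_vector_derivative X) (at t within S)" "x t = mat 1"
    and inv: "((\<lambda>s. matrix_inv (x s)) has_vector_derivative - X) (at t within S)"
  shows "((\<lambda>s. embedding (x s)) has_vector_derivative dembedding X) (at t within S)"
proof -
  have lin: "((\<lambda>s. lin (x s)) has_vector_derivative dlin X) (at t within S)"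
    by (rule lin_has_vector_derivative[OF x])
  have "((\<lambda>s. lin (matrix_inv (x s))) has_vector_derivative dlin (- X)) (at t within S)"
    by (rule lin_has_vector_derivative[OF inv]) (simp add: x)
  from bounded_linear.has_vector_derivative[OF bounded_linear_transpose this]
  have "((\<lambda>s. dual (x s)) has_vector_derivative transpose (dlin (- X))) (at t within S)"
    by (simp only: dual_def)
  moreover have "transpose (- M) = - transpose M" for M :: "real^'n^'n"
    by (simp add: transpose_def vec_eq_iff)
  ultimately have dual: "((\<lambda>s. dual (x s)) has_vector_derivative - transpose (dlin X)) (at t within S)"
    by (simp only: dlin_minus)
  have shear: "((\<lambda>s. shear (last_column (x s))) has_vector_derivative shear (\<lambda>i. X $ \<iota> i $ p)) (at t within S)"
  proof (rule has_vector_derivative_matrix_entries)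
    fix i j
    have "((\<lambda>s. if P then last_column (x s) k else 0) has_real_derivative (if P then X $ \<iota> k $ p else 0))
        (at t within S)" for P k
      by (cases P) (auto intro: last_column_has_derivative[OF x])
    from DERIV_add[OF this[of "i = o\<^sub>n" j] this[of "j = o\<^sub>n" i]]
    show "((\<lambda>s. shear (last_column (x s)) $ i $ j) has_vector_derivative shear (\<lambda>i. X $ \<iota> i $ p) $ i $ j) (at t within S)"
      by (simp add: shear_def has_real_derivative_iff_has_vector_derivative)
  qed
  have "dual (x t) = mat 1" by (simp add: x(2) dual_def lin_one)
  moreover have "shear (last_column (x t)) = 0"
    by (simp add: x(2) shear_def last_column_def vec_eq_iff mat_def \<iota>_neq_p)
  ultimately have at_t: "shear (last_column (x t)) = 0" "dual (x t) = mat 1" by simp_all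
  have T: "((\<lambda>s. shear (last_column (x s)) ** dual (x s)) has_vector_derivative shear (\<lambda>i. X $ \<iota> i $ p)) (at t within S)"
    using has_vector_derivative_matrix_mult[OF shear dual] by (simp add: at_t)
  show ?thesis
    unfolding embedding_def dembedding_def
    by (rule has_vector_derivative_block_matrix[OF lin T has_vector_derivative_const dual refl])
qed

text \<open>Multiplicativity reduces the derivative at \<open>t\<close> to that along the translated
  curve \<eta>, which passes through the identity. Logarithmic derivatives in Sp are thus a fixed
  linear image of those in SL.\<close>

lemma embedding_curve:
  fixes \<beta> :: "real \<Rightarrow> real^'m^'m"
  assumes mem: "\<And>t. t \<in> S \<Longrightarrow> \<beta> t \<in> triangular_group"
    and d: "\<And>t. t \<in> S \<Longrightarrow> (\<beta> has_vector_derivative \<beta> t ** A t) (at t within S)"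
    and t: "t \<in> S"
  shows "((\<lambda>s. embedding (\<beta> s)) has_vector_derivative embedding (\<beta> t) ** dembedding (A t)) (at t within S)"
proof -
  define g where "g = matrix_inv (\<beta> t)"
  define \<eta> where "\<eta> s = g ** \<beta> s" for s
  have g: "g \<in> triangular_group" "\<beta> t ** g = mat 1" "g ** \<beta> t = mat 1" "invertible g"
    using triangular_group_inv(1)[OF mem[OF t]] triangular_groupD(4)[OF mem[OF t]]
    by (auto simp: g_def matrix_inv_left matrix_inv_right invertible_matrix_inv)
  have \<eta>: "(\<eta> has_vector_derivative A t) (at t within S)" "\<eta> t = mat 1"
    using has_vector_derivative_matrix_mult[OF has_vector_derivative_const[of g] d[OF t]]
    by (simp_all add: \<eta>_def[abs_def] matrix_mul_assoc g)
  have cont: "continuous_on S \<beta>"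
    using d has_vector_derivative_continuous continuous_on_eq_continuous_within by blast
  have "((\<lambda>s. matrix_inv (\<beta> s)) has_vector_derivative - (A t ** g)) (at t within S)"
    unfolding g_def by (rule has_vector_derivative_matrix_inv[OF d[OF t] t cont]) (rule triangular_groupD(3)[OF mem])
  from has_vector_derivative_matrix_mult[OF this has_vector_derivative_const[of "\<beta> t"]]
  have "((\<lambda>s. matrix_inv (\<beta> s) ** \<beta> t) has_vector_derivative - A t) (at t within S)"
    by (simp add: matrix_mult_linear_simps matrix_mul_assoc[symmetric] g)
  then have "((\<lambda>s. matrix_inv (\<eta> s)) has_vector_derivative - A t) (at t within S)"
  proof (rule has_vector_derivative_transform[OF t, rotated])
    fix s assume "s \<in> S"
    then show "matrix_inv (\<eta> s) = matrix_inv (\<beta> s) ** \<beta> t"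
      using matrix_inv_mult[OF g(4) triangular_groupD(4)[OF mem[of s]]]
        matrix_inv_matrix_inv[OF triangular_groupD(4)[OF mem[OF t]]]
      by (simp add: \<eta>_def g_def)
  qed
  from embedding_has_vector_derivative_at_one[OF \<eta> this]
  have "((\<lambda>s. embedding (\<eta> s)) has_vector_derivative dembedding (A t)) (at t within S)" .
  from has_vector_derivative_matrix_mult[OF has_vector_derivative_const[of "embedding (\<beta> t)"] this]
  have "((\<lambda>s. embedding (\<beta> t) ** embedding (\<eta> s)) has_vector_derivative
      embedding (\<beta> t) ** dembedding (A t)) (at t within S)" by simp
  then show ?thesis
  proof (rule has_vector_derivative_transform[OF t, rotated])
    fix s assume s: "s \<in> S"
    have "\<beta> t ** \<eta> s = \<beta> s" by (simp add: \<eta>_def matrix_mul_assoc g)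
    then show "embedding (\<beta> s) = embedding (\<beta> t) ** embedding (\<eta> s)"
      using embedding_mult[OF mem[OF t], of "\<eta> s"] triangular_group_mult[OF g(1) mem[OF s]]
      by (simp add: \<eta>_def)
  qed
qed

end

context symplectic_embedding
begin

subsection \<open>Polynomial distortion of the embedding\<close>

lemma embedding_entry_bounds:
  "\<bar>lin b $ i $ j\<bar> \<le> norm (embedding b)"
  "\<bar>(shear (last_column b) ** dual b) $ i $ j\<bar> \<le> norm (embedding b)"
  "\<bar>dual b $ i $ j\<bar> \<le> norm (embedding b)"
  using abs_entry_le_norm[of "embedding b" "Inl i" "Inl j"] abs_entry_le_norm[of "embedding b" "Inl i" "Inr j"]
    abs_entry_le_norm[of "embedding b" "Inr i" "Inr j"]
  by (simp_all add: embedding_def)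

text \<open>The diagonals of \<open>lin\<close> and \<open>dual\<close> bound z_i and 1 / z_i by
  \<open>y\<close>, which controls \<open>b\<close> only up to the factor \<open>scale\<close>; the
  determinant condition then recovers the scale from the z_i.\<close>

lemma embedding_diagonal_bounds:
  assumes b: "b \<in> triangular_group"
  defines "y \<equiv> norm (embedding b)"
  shows "1 \<le> y" "scale b \<le> y" "1 / scale b \<le> y" "b $ p $ p \<le> y * y" "\<bar>b $ \<iota> i $ \<iota> j\<bar> \<le> y * y"
proof -
  let ?s = "scale b"
  note bpos = triangular_groupD(2)[OF b]
  note lin_y = embedding_entry_bounds(1)[of b, folded y_def]
  note dual_y = embedding_entry_bounds(3)[of b, folded y_def]
  have s: "0 < ?s" by (rule scale_pos[OF b])
  define z where "z i = ?s * b $ \<iota> i $ \<iota> i" for i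
  have zpos: "0 < z i" for i using s bpos by (simp add: z_def)
  have z_le: "z i \<le> y" for i
    using lin_y[of i i] zpos[of i] by (simp add: lin_def sub_def z_def)
  have z_inv: "1 / z i \<le> y" for i
  proof -
    have "scale (matrix_inv b) = 1 / ?s"
    proof -
      have "scale (mat 1) = 1" by (simp add: scale_def mat_def)
      moreover have "scale (b ** matrix_inv b) = ?s * scale (matrix_inv b)"
        by (rule scale_mult[OF b triangular_group_inv(1)[OF b]])
      ultimately have "scale (matrix_inv b) * ?s = 1"
        by (simp add: matrix_inv_right[OF triangular_groupD(4)[OF b]] mult.commute)
      then show ?thesis using s by (intro nonzero_eq_divide_eq[THEN iffD2]) simp_all
    qed
    then have "dual b $ i $ i = 1 / z i"
      unfolding dual_def lin_def sub_def transpose_def z_def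
      by (simp only: vec_lambda_beta vector_scaleR_component real_scaleR_def triangular_group_inv(2)[OF b]
          times_divide_times_eq mult_1_left)
    then show ?thesis using dual_y[of i i] zpos[of i] by simp
  qed
  have "z o\<^sub>n * (1 / z o\<^sub>n) \<le> y * y"
    using z_le z_inv zpos by (intro mult_mono) (simp_all add: less_imp_le y_def)
  then have "1\<^sup>2 \<le> y\<^sup>2" using zpos[of o\<^sub>n] by (simp add: power2_eq_square)
  then show y1: "1 \<le> y" by (rule power2_le_imp_le) (simp add: y_def)
  have sz: "?s * z o\<^sub>n * b $ p $ p = 1"
  proof -
    have "?s * z o\<^sub>n * b $ p $ p = (?s * ?s) * (b $ p $ p * b $ \<iota> o\<^sub>n $ \<iota> o\<^sub>n)"
      unfolding z_def by (simp only: mult_ac)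
    then show ?thesis
      unfolding scale_square[OF b] using bpos[of p] bpos[of "\<iota> o\<^sub>n"] by simp
  qed
  \<comment> \<open>Determinant 1 and \<open>sz\<close> together eliminate b_pp; taking roots of
    order CARD('n) + 1 afterwards bounds the scale from both sides.\<close>
  have z_prod: "(\<Prod>i\<in>UNIV. z i) = ?s ^ (CARD('n) + 1) * z o\<^sub>n"
  proof -
    have "(\<Prod>k\<in>UNIV. b $ k $ k) = (\<Prod>k\<in>range \<iota>. b $ k $ k) * b $ p $ p"
      using prod.remove[of UNIV p "\<lambda>k. b $ k $ k"] by (simp add: range_\<iota> Compl_eq_Diff_UNIV mult.commute)
    then have "(\<Prod>i\<in>UNIV. b $ \<iota> i $ \<iota> i) * b $ p $ p = 1"
      using det_upper_triangular[OF triangular_groupD(1)[OF b]] triangular_groupD(3)[OF b]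
      by (simp add: prod.reindex[OF inj_\<iota>])
    then have "(\<Prod>i\<in>UNIV. z i) * b $ p $ p = ?s ^ CARD('n)"
      by (simp add: z_def prod.distrib mult.assoc)
    also have "\<dots> = ?s ^ CARD('n) * (?s * z o\<^sub>n * b $ p $ p)" unfolding sz by simp
    finally have "(\<Prod>i\<in>UNIV. z i) * b $ p $ p = (?s ^ (CARD('n) + 1) * z o\<^sub>n) * b $ p $ p"
      by (simp only: power_add power_one_right mult.assoc)
    then show ?thesis using bpos[of p] by simp
  qed
  show s_le: "?s \<le> y"
  proof -
    have "?s ^ (CARD('n) + 1) = (\<Prod>i\<in>UNIV. z i) * (1 / z o\<^sub>n)"
      unfolding z_prod using zpos[of o\<^sub>n] by simp
    also have "\<dots> \<le> (\<Prod>i\<in>(UNIV :: 'n set). y) * y"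
      using z_le z_inv zpos y1 by (intro mult_mono prod_mono) (auto simp: less_imp_le)
    also have "\<dots> = y ^ (CARD('n) + 1)" by simp
    finally have "?s ^ Suc CARD('n) \<le> y ^ Suc CARD('n)" by (simp only: Suc_eq_plus1)
    then show ?thesis by (rule power_le_imp_le_base) (use y1 in linarith)
  qed
  show s_inv: "1 / ?s \<le> y"
  proof -
    have "(1 / ?s) ^ (CARD('n) + 1) = (\<Prod>i\<in>UNIV. 1 / z i) * z o\<^sub>n"
      using zpos[of o\<^sub>n] s by (simp add: prod_dividef z_prod power_one_over)
    also have "\<dots> \<le> (\<Prod>i\<in>(UNIV :: 'n set). y) * y"
      using z_le z_inv zpos y1 by (intro mult_mono prod_mono) (auto simp: less_imp_le)
    also have "\<dots> = y ^ (CARD('n) + 1)" by simp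
    finally have "(1 / ?s) ^ Suc CARD('n) \<le> y ^ Suc CARD('n)" by (simp only: Suc_eq_plus1)
    then show ?thesis by (rule power_le_imp_le_base) (use y1 in linarith)
  qed
  show "\<bar>b $ \<iota> i $ \<iota> j\<bar> \<le> y * y"
  proof -
    have "b $ \<iota> i $ \<iota> j = 1 / ?s * lin b $ i $ j" using s by (simp add: lin_def sub_def)
    then have "\<bar>b $ \<iota> i $ \<iota> j\<bar> = 1 / ?s * \<bar>lin b $ i $ j\<bar>" using s by (simp add: abs_mult)
    also have "\<dots> \<le> y * y" using s s_inv lin_y y1 by (intro mult_mono) auto
    finally show ?thesis .
  qed
  show p_le: "b $ p $ p \<le> y * y"
  proof -
    have "b $ p $ p = (1 / ?s) * (1 / z o\<^sub>n)"
      using sz s zpos[of o\<^sub>n] by (simp add: eq_divide_eq mult_ac)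
    also have "\<dots> \<le> y * y" using s s_inv z_inv zpos y1 by (intro mult_mono) (auto simp: less_imp_le)
    finally show ?thesis .
  qed
qed

text \<open>Multiplying the upper right block by the transpose of \<open>lin\<close> removes
  \<open>dual\<close> and isolates the shear, at the cost of a sum of CARD('n) products of
  entries.\<close>

lemma last_column_bound:
  assumes b: "b \<in> triangular_group"
  defines "y \<equiv> norm (embedding b)"
  shows "\<bar>last_column b i\<bar> \<le> real CARD('n) * (y * y)"
proof -
  let ?N = "real CARD('n)"
  note lin_y = embedding_entry_bounds(1)[of b, folded y_def]
  note T_y = embedding_entry_bounds(2)[of b, folded y_def]
  have y1: "1 \<le> y" unfolding y_def by (rule embedding_diagonal_bounds[OF b])
  have shear_le: "\<bar>shear (last_column b) $ i $ j\<bar> \<le> ?N * (y * y)" for i j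
  proof -
    have "shear (last_column b) = (shear (last_column b) ** dual b) ** transpose (lin b)"
      by (simp add: lin_dual(3)[OF b] flip: matrix_mul_assoc)
    then have "shear (last_column b) $ i $ j =
        ((shear (last_column b) ** dual b) ** transpose (lin b)) $ i $ j"
      by (rule arg_cong)
    also have "\<dots> = (\<Sum>k\<in>UNIV. (shear (last_column b) ** dual b) $ i $ k * lin b $ j $ k)"
      unfolding matrix_matrix_mult_def[of _ "transpose (lin b)"] by (simp add: transpose_def)
    also have "\<bar>\<dots>\<bar> \<le> (\<Sum>k\<in>(UNIV :: 'n set). y * y)"
      using y1
      by (intro order_trans[OF sum_abs sum_mono]) (auto simp: abs_mult intro!: mult_mono T_y lin_y)
    finally show ?thesis by simp
  qed
  show ?thesis
  proof -
    \<comment> \<open>Column \<open>o\<^sub>n\<close> of the shear is w itself, with its entry at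
      \<open>o\<^sub>n\<close> doubled.\<close>
    have "\<bar>last_column b i\<bar> \<le> \<bar>shear (last_column b) $ i $ o\<^sub>n\<bar>" by (simp add: shear_def abs_mult)
    then show ?thesis using shear_le[of i "o\<^sub>n"] by linarith
  qed
qed

text \<open>Entries outside the last column, and b_pp, are at most y^2. The rest of the last column
  is a normalized entry times b_pp, at most CARD('n) * y^4. The exponent 6 covers all cases.\<close>

lemma norm_le_norm_embedding:
  assumes b: "b \<in> triangular_group"
  defines "y \<equiv> norm (embedding b)"
  shows "norm b \<le> real CARD('m) * real CARD('m) * (real CARD('n) * y ^ 6)"
proof -
  let ?N = "real CARD('n)"
  note bpos = triangular_groupD(2)[OF b]
  note diag = embedding_diagonal_bounds[OF b, folded y_def]
  note y1 = diag(1)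
  have N1: "1 \<le> ?N" by (simp add: Suc_leI)
  have pow: "y ^ k \<le> ?N * y ^ 6" if "k \<le> 6" for k
  proof -
    have "1 * y ^ k \<le> ?N * y ^ 6"
      using N1 y1 that by (intro mult_mono power_increasing) auto
    then show ?thesis by simp
  qed
  have entry: "\<bar>b $ i $ j\<bar> \<le> ?N * y ^ 6" for i j
  proof (cases "i = p")
    case True
    show ?thesis
    proof (cases "j = p")
      case True
      then show ?thesis using \<open>i = p\<close> diag(4) bpos[of p] pow[of 2] by (simp add: power2_eq_square)
    next
      case False
      then have "b $ i $ j = 0"
        using \<open>i = p\<close> p_max[OF False] triangular_groupD(1)[OF b] by (simp add: upper_triangular_def)
      then show ?thesis using y1 by simp
    qed
  next
    case False
    then obtain k where k: "i = \<iota> k" using range_\<iota> by (metis ComplI rangeE singletonD)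
    show ?thesis
    proof (cases "j = p")
      case True
      have "\<bar>b $ i $ j\<bar> = \<bar>last_column b k\<bar> * b $ p $ p"
        using bpos[of p] by (simp add: True k last_column_def abs_mult)
      also have "\<dots> \<le> (?N * (y * y)) * (y * y)"
        using bpos[of p] y1 by (intro mult_mono last_column_bound[OF b, folded y_def] diag(4)) auto
      also have "\<dots> = ?N * y ^ 4" by (simp add: power2_eq_square power4_eq_xxxx mult.assoc)
      also have "\<dots> \<le> ?N * y ^ 6" using y1 by (intro mult_left_mono power_increasing) auto
      finally show ?thesis .
    next
      case False
      then obtain l where "j = \<iota> l" using range_\<iota> by (metis ComplI rangeE singletonD)
      then show ?thesis using diag(5)[of k l] pow[of 2] k by (simp add: power2_eq_square)
    qed
  qed
  show "norm b \<le> real CARD('m) * real CARD('m) * (real CARD('n) * y ^ 6)"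
    using norm_matrix_le_const[OF entry] by simp
qed

end

section \<open>The quasi-isometric embedding\<close>

lemma quasi_isometric_embeddingI:
  fixes a b c d :: real
  assumes "f ` X \<subseteq> Y" and "0 \<le> b" "0 \<le> d"
    and le: "\<And>x y. x \<in> X \<Longrightarrow> y \<in> X \<Longrightarrow> 0 \<le> dX x y \<and> 0 \<le> dY (f x) (f y) \<and>
      dX x y \<le> a + b * dY (f x) (f y) \<and> dY (f x) (f y) \<le> c + d * dX x y"
  shows "quasi_isometric_embedding X dX Y dY f"
proof -
  \<comment> \<open>\<open>K\<close> dominates both slopes, and being at least 1 it does not enlarge
    the additive constant when divided out.\<close>
  define K where "K = 1 + b + d"
  define C where "C = \<bar>a\<bar> + \<bar>c\<bar>"
  have K: "1 \<le> K" "b \<le> K" "d \<le> K" using assms by (auto simp: K_def)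
  have "1 / K * dX x y - C \<le> dY (f x) (f y) \<and> dY (f x) (f y) \<le> K * dX x y + C"
    if "x \<in> X" "y \<in> X" for x y
  proof
    note * = le[OF that]
    have "d * dX x y \<le> K * dX x y" using K * by (intro mult_right_mono) auto
    then show "dY (f x) (f y) \<le> K * dX x y + C" using * unfolding C_def by linarith
    have "b * dY (f x) (f y) \<le> K * dY (f x) (f y)" using K * by (intro mult_right_mono) auto
    moreover have "1 * C \<le> K * C" using K by (intro mult_right_mono) (auto simp: C_def)
    moreover have "a \<le> C" by (simp add: C_def)
    ultimately have "dX x y \<le> K * (dY (f x) (f y) + C)" using * by (simp add: distrib_left)
    then have "dX x y / K \<le> dY (f x) (f y) + C"
      using K by (simp add: pos_divide_le_eq mult.commute)
    then show "1 / K * dX x y - C \<le> dY (f x) (f y)" by simp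
  qed
  then show ?thesis
    unfolding quasi_isometric_embedding_def KC_quasi_isometric_embedding_def
    using assms(1) K by (intro exI[of _ K] exI[of _ C]) (auto simp: C_def)
qed

text \<open>The diagonal entries multiply to 1, so they cannot all be below 1. This later allows 1 +
  norm to be replaced by twice the norm.\<close>

lemma (in index_order) one_le_norm:
  assumes "b \<in> triangular_group"
  shows "1 \<le> norm b"
proof (rule ccontr)
  assume "\<not> 1 \<le> norm b"
  then have "b $ i $ i < 1" for i
    using abs_entry_le_norm[of b i i] by linarith
  then have "ln (b $ i $ i) < 0" for i
    using triangular_groupD(2)[OF assms, of i] by simp
  then have "(\<Sum>i\<in>UNIV. ln (b $ i $ i)) < (\<Sum>i\<in>(UNIV :: 'm set). 0)"
    by (intro sum_strict_mono) auto
  moreover have "(\<Sum>i\<in>UNIV. ln (b $ i $ i)) = ln (\<Prod>i\<in>UNIV. b $ i $ i)"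
  proof (rule ln_prod[symmetric])
    show "b $ i $ i \<noteq> 0" for i using triangular_groupD(2)[OF assms, of i] by simp
  qed simp
  ultimately show False
    using det_upper_triangular[OF triangular_groupD(1)[OF assms]] triangular_groupD(3)[OF assms] by simp
qed

context symplectic_embedding
begin

lemma coset_space_quasi_isometric_embedding:
  assumes P: "invariant_riemannian_metric (SL :: (real^'m^'m) set) SO P"
    and Q: "invariant_riemannian_metric (Sp :: (real^('n + 'n)^('n + 'n)) set) U Q"
  shows "\<exists>f. quasi_isometric_embedding (coset_space SL SO) (riemannian_dist SL P)
               (coset_space Sp U) (riemannian_dist Sp Q) f"
proof -
  let ?d1 = "\<lambda>b c. riemannian_dist SL P (left_coset SO b) (left_coset SO c)"
  let ?d2 = "\<lambda>b c. riemannian_dist Sp Q (left_coset U (embedding b)) (left_coset U (embedding c))"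
  obtain C where C: "0 \<le> C"
    "\<And>b. b \<in> triangular_group \<Longrightarrow> \<exists>\<beta> A v I. \<beta> 0 = mat 1 \<and> \<beta> 1 = b \<and>
       (\<forall>t\<in>{0..1}. \<beta> t \<in> triangular_group) \<and>
       (\<forall>t\<in>{0..1}. (\<beta> has_vector_derivative \<beta> t ** A t) (at t within {0..1})) \<and>
       continuous_on {0..1} A \<and> (\<forall>t\<in>{0..1}. norm (A t) \<le> v t) \<and>
       (v has_integral I) {0..1} \<and> I \<le> C * (1 + ln (1 + norm b))"
    by (rule triangular_path, rule that) blast+
  obtain B1 where B1: "B1 > 0" and up1: "\<And>\<gamma> A v I. (\<And>t. t \<in> {0..1} \<Longrightarrow> \<gamma> t \<in> SL) \<Longrightarrow>
       (\<And>t. t \<in> {0..1} \<Longrightarrow> (\<gamma> has_vector_derivative \<gamma> t ** A t) (at t within {0..1})) \<Longrightarrow>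
       continuous_on {0..1} A \<Longrightarrow> (\<And>t. t \<in> {0..1} \<Longrightarrow> norm (A t) \<le> v t) \<Longrightarrow>
       (v has_integral I) {0..1} \<Longrightarrow>
       curve_lengths SL P (left_coset SO (\<gamma> 0)) (left_coset SO (\<gamma> 1)) \<noteq> {} \<and>
       riemannian_dist SL P (left_coset SO (\<gamma> 0)) (left_coset SO (\<gamma> 1)) \<le> B1 * I"
    by (rule SL_SO.riemannian_dist_upper_bound[OF P], rule that) blast+
  obtain B2 where B2: "B2 > 0" and up2: "\<And>\<gamma> A v I. (\<And>t. t \<in> {0..1} \<Longrightarrow> \<gamma> t \<in> Sp) \<Longrightarrow>
       (\<And>t. t \<in> {0..1} \<Longrightarrow> (\<gamma> has_vector_derivative \<gamma> t ** A t) (at t within {0..1})) \<Longrightarrow>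
       continuous_on {0..1} A \<Longrightarrow> (\<And>t. t \<in> {0..1} \<Longrightarrow> norm (A t) \<le> v t) \<Longrightarrow>
       (v has_integral I) {0..1} \<Longrightarrow>
       curve_lengths Sp Q (left_coset U (\<gamma> 0)) (left_coset U (\<gamma> 1)) \<noteq> {} \<and>
       riemannian_dist Sp Q (left_coset U (\<gamma> 0)) (left_coset U (\<gamma> 1)) \<le> B2 * I"
    by (rule Sp_U.riemannian_dist_upper_bound[OF Q], rule that) blast+
  obtain c1 where c1: "c1 > 0"
    and low1: "\<And>x y. x \<in> SL \<Longrightarrow> y \<in> SL \<Longrightarrow> curve_lengths SL P (left_coset SO x) (left_coset SO y) \<noteq> {} \<Longrightarrow>
       c1 * (ln (norm (matrix_inv x ** y)) - ln (norm (mat 1 :: real^'m^'m))) \<le> ?d1 x y"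
    and nonneg1: "\<And>x y. x \<in> SL \<Longrightarrow> y \<in> SL \<Longrightarrow> curve_lengths SL P (left_coset SO x) (left_coset SO y) \<noteq> {} \<Longrightarrow>
       0 \<le> ?d1 x y"
    by (rule SL_SO.riemannian_dist_lower_bound[OF P], rule that) blast+
  obtain c2 where c2: "c2 > 0"
    and low2: "\<And>x y. x \<in> Sp \<Longrightarrow> y \<in> Sp \<Longrightarrow> curve_lengths Sp Q (left_coset U x) (left_coset U y) \<noteq> {} \<Longrightarrow>
       c2 * (ln (norm (matrix_inv x ** y)) - ln (norm (mat 1 :: real^('n + 'n)^('n + 'n))))
         \<le> riemannian_dist Sp Q (left_coset U x) (left_coset U y)"
    and nonneg2: "\<And>x y. x \<in> Sp \<Longrightarrow> y \<in> Sp \<Longrightarrow> curve_lengths Sp Q (left_coset U x) (left_coset U y) \<noteq> {} \<Longrightarrow>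
       0 \<le> riemannian_dist Sp Q (left_coset U x) (left_coset U y)"
    by (rule Sp_U.riemannian_dist_lower_bound[OF Q], rule that) blast+
  obtain M where M: "0 < M" "\<And>X. norm (dembedding X) \<le> norm X * M"
    using bounded_linear.pos_bounded[OF bounded_linear_dembedding] by blast
  define n1 where "n1 = ln (norm (mat 1 :: real^'m^'m))"
  define n2 where "n2 = ln (norm (mat 1 :: real^('n + 'n)^('n + 'n)))"
  define k where "k = real CARD('m) * real CARD('m) * real CARD('n)"
  have k1: "0 < k" by (simp add: k_def)
  define \<alpha>1 \<alpha>2 where "\<alpha>1 = B1 * C" and "\<alpha>2 = B2 * (M * C)"
  have \<alpha>: "0 \<le> \<alpha>1" "0 \<le> \<alpha>2" using B1 B2 M C by (auto simp: \<alpha>1_def \<alpha>2_def)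
  \<comment> \<open>Both distances are compared with the logarithm \<open>X\<close> below: the upper
    bound in one space and the lower bound in the other combine to each inequality.\<close>
  have bounds: "0 \<le> ?d1 b c \<and> 0 \<le> ?d2 b c \<and>
      ?d1 b c \<le> \<alpha>1 * (1 + (ln (2 * k) + 6 * n2)) + (\<alpha>1 * (6 / c2)) * ?d2 b c \<and>
      ?d2 b c \<le> \<alpha>2 * (1 + (ln 2 + n1)) + (\<alpha>2 / c1) * ?d1 b c"
    if b: "b \<in> triangular_group" and c: "c \<in> triangular_group" for b c
  proof -
    define a where "a = matrix_inv b ** c"
    have a: "a \<in> triangular_group"
      unfolding a_def by (intro triangular_group_mult triangular_group_inv b c)
    have ba: "b ** a = c"
      by (simp add: a_def matrix_mul_assoc matrix_inv_right triangular_groupD(4)[OF b])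
    define X where "X = ln (1 + norm a)"
    define Y where "Y = ln (norm (embedding a))"
    obtain \<beta> A v I where \<beta>: "\<beta> 0 = mat 1" "\<beta> 1 = a" "\<And>t. t \<in> {0..1} \<Longrightarrow> \<beta> t \<in> triangular_group"
      "\<And>t. t \<in> {0..1} \<Longrightarrow> (\<beta> has_vector_derivative \<beta> t ** A t) (at t within {0..1})"
      "continuous_on {0..1} A" "\<And>t. t \<in> {0..1} \<Longrightarrow> norm (A t) \<le> v t"
      "(v has_integral I) {0..1}" "I \<le> C * (1 + X)"
      using C(2)[OF a] unfolding X_def by blast
    \<comment> \<open>The same triangular curve from \<open>mat 1\<close> to \<open>a\<close> serves
      both spaces: translated by \<open>b\<close> here, and mapped to Sp and translated by
      \<open>embedding b\<close> next.\<close>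
    have 1: "curve_lengths SL P (left_coset SO b) (left_coset SO c) \<noteq> {} \<and> ?d1 b c \<le> B1 * I"
    proof -
      have "b ** \<beta> t \<in> SL" if "t \<in> {0..1}" for t
        using triangular_groupD(5)[OF triangular_group_mult[OF b \<beta>(3)[OF that]]] .
      moreover have "((\<lambda>t. b ** \<beta> t) has_vector_derivative b ** \<beta> t ** A t) (at t within {0..1})"
        if "t \<in> {0..1}" for t
        using has_vector_derivative_matrix_mult[OF has_vector_derivative_const[of b] \<beta>(4)[OF that]]
        by (simp add: matrix_mul_assoc)
      ultimately show ?thesis
        using up1[of "\<lambda>t. b ** \<beta> t" A v I] \<beta>(1,2,5-7) ba by simp
    qed
    have 2: "curve_lengths Sp Q (left_coset U (embedding b)) (left_coset U (embedding c)) \<noteq> {} \<and>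
        ?d2 b c \<le> B2 * (M * I)"
    proof -
      have "embedding b ** embedding (\<beta> t) \<in> Sp" if "t \<in> {0..1}" for t
        by (intro Sp_U.mult_in_G embedding_in_Sp b \<beta>(3) that)
      moreover have "((\<lambda>t. embedding b ** embedding (\<beta> t)) has_vector_derivative
          embedding b ** embedding (\<beta> t) ** dembedding (A t)) (at t within {0..1})"
        if "t \<in> {0..1}" for t
        using has_vector_derivative_matrix_mult[OF has_vector_derivative_const[of "embedding b"]
            embedding_curve[of "{0..1}" \<beta> A t, OF \<beta>(3,4) that]]
        by (simp add: matrix_mul_assoc)
      moreover have "continuous_on {0..1} (\<lambda>t. dembedding (A t))"
        by (rule bounded_linear.continuous_on[OF bounded_linear_dembedding \<beta>(5)])
      moreover have "norm (dembedding (A t)) \<le> M * v t" if "t \<in> {0..1}" for t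
      proof -
        have "norm (dembedding (A t)) \<le> M * norm (A t)" using M(2)[of "A t"] by (simp add: mult.commute)
        also have "\<dots> \<le> M * v t" using M(1) \<beta>(6)[OF that] by simp
        finally show ?thesis .
      qed
      moreover have "((\<lambda>t. M * v t) has_integral M * I) {0..1}"
        by (rule has_integral_mult_right[OF \<beta>(7)])
      ultimately show ?thesis
        using up2[of "\<lambda>t. embedding b ** embedding (\<beta> t)" "\<lambda>t. dembedding (A t)" "\<lambda>t. M * v t" "M * I"]
          \<beta>(1,2) ba embedding_mult[OF b a] by (simp add: embedding_one)
    qed
    note SL = triangular_groupD(5)[OF b] triangular_groupD(5)[OF c]
    note Sp = embedding_in_Sp[OF b] embedding_in_Sp[OF c]
    have d1: "0 \<le> ?d1 b c" using nonneg1[OF SL] 1 by blast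
    have d2: "0 \<le> ?d2 b c" using nonneg2[OF Sp] 2 by blast
    have "B1 * I \<le> B1 * (C * (1 + X))" using B1 \<beta>(8) by simp
    then have up1': "?d1 b c \<le> \<alpha>1 * (1 + X)" using 1 by (simp add: \<alpha>1_def mult.assoc)
    have "B2 * (M * I) \<le> B2 * (M * (C * (1 + X)))" using B2 M \<beta>(8) by simp
    then have up2': "?d2 b c \<le> \<alpha>2 * (1 + X)" using 2 by (simp add: \<alpha>2_def mult.assoc)
    have na: "1 \<le> norm a" by (rule one_le_norm[OF a])
    have X1: "X \<le> (ln 2 + n1) + ?d1 b c / c1"
    proof -
      have "X \<le> ln (2 * norm a)" unfolding X_def using na by (intro ln_mono) auto
      also have "\<dots> = ln 2 + ln (norm a)" using na by (intro ln_mult_pos) auto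
      finally have "X \<le> ln 2 + ln (norm a)" .
      moreover have "c1 * (ln (norm a) - n1) \<le> ?d1 b c"
        using low1[OF SL] 1 by (simp add: a_def n1_def)
      then have "ln (norm a) - n1 \<le> ?d1 b c / c1" using c1 by (simp add: pos_le_divide_eq mult.commute)
      ultimately show ?thesis by linarith
    qed
    have X2: "X \<le> (ln (2 * k) + 6 * n2) + (6 / c2) * ?d2 b c"
    proof -
      let ?y = "norm (embedding a)"
      have y1: "1 \<le> ?y" by (rule embedding_diagonal_bounds(1)[OF a])
      have "norm a \<le> k * ?y ^ 6" using norm_le_norm_embedding[OF a] by (simp add: k_def mult.assoc)
      then have "X \<le> ln ((2 * k) * ?y ^ 6)" unfolding X_def using na by (intro ln_mono) auto
      also have "\<dots> = ln (2 * k) + ln (?y ^ 6)" using k1 y1 by (intro ln_mult_pos zero_less_power) auto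
      also have "ln (?y ^ 6) = 6 * Y" using y1 by (simp add: Y_def ln_realpow)
      finally have "X \<le> ln (2 * k) + 6 * Y" .
      moreover have "c2 * (Y - n2) \<le> ?d2 b c"
      proof -
        have "matrix_inv (embedding b) ** embedding c = embedding a"
          unfolding ba[symmetric] embedding_mult[OF b a] matrix_mul_assoc
          by (simp add: matrix_inv_left[OF Sp_U.invertible_G[OF Sp(1)]])
        then show ?thesis using low2[OF Sp] 2 by (simp add: Y_def n2_def)
      qed
      then have "Y - n2 \<le> ?d2 b c / c2" using c2 by (simp add: pos_le_divide_eq mult.commute)
      ultimately show ?thesis by simp
    qed
    have "\<alpha>1 * (1 + X) \<le> \<alpha>1 * (1 + ((ln (2 * k) + 6 * n2) + (6 / c2) * ?d2 b c))"
      using X2 \<alpha> by (intro mult_left_mono) auto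
    moreover have "\<alpha>2 * (1 + X) \<le> \<alpha>2 * (1 + ((ln 2 + n1) + ?d1 b c / c1))"
      using X1 \<alpha> by (intro mult_left_mono) auto
    ultimately show ?thesis
      using d1 d2 up1' up2' by (simp add: distrib_left mult.assoc)
  qed
  \<comment> \<open>An arbitrary choice of triangular representatives is enough, because
    \<open>bounds\<close> holds for all of them.\<close>
  define rep where "rep x = (SOME b. b \<in> triangular_group \<and> left_coset SO b = x)" for x
  have rep: "rep x \<in> triangular_group" "left_coset SO (rep x) = x" if x: "x \<in> coset_space SL SO" for x
  proof -
    obtain g where "g \<in> SL" "x = left_coset SO g" using x by (auto simp: coset_space_def)
    then have "\<exists>b. b \<in> triangular_group \<and> left_coset SO b = x"
      using triangular_representative[of g] by blast
    from someI_ex[OF this] show "rep x \<in> triangular_group" "left_coset SO (rep x) = x"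
      by (auto simp: rep_def)
  qed
  show ?thesis
  proof (rule exI, rule quasi_isometric_embeddingI)
    show "(\<lambda>x. left_coset U (embedding (rep x))) ` coset_space SL SO \<subseteq> coset_space Sp U"
      using rep(1) embedding_in_Sp by (auto simp: coset_space_def)
    show "0 \<le> \<alpha>1 * (6 / c2)" "0 \<le> \<alpha>2 / c1" using \<alpha> c1 c2 by auto
  next
    fix x y :: "(real^'m^'m) set"
    assume x: "x \<in> coset_space SL SO" and y: "y \<in> coset_space SL SO"
    show "0 \<le> riemannian_dist SL P x y \<and>
        0 \<le> riemannian_dist Sp Q (left_coset U (embedding (rep x))) (left_coset U (embedding (rep y))) \<and>
        riemannian_dist SL P x y \<le> \<alpha>1 * (1 + (ln (2 * k) + 6 * n2)) + (\<alpha>1 * (6 / c2)) *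
          riemannian_dist Sp Q (left_coset U (embedding (rep x))) (left_coset U (embedding (rep y))) \<and>
        riemannian_dist Sp Q (left_coset U (embedding (rep x))) (left_coset U (embedding (rep y)))
          \<le> \<alpha>2 * (1 + (ln 2 + n1)) + (\<alpha>2 / c1) * riemannian_dist SL P x y"
      using bounds[OF rep(1)[OF x] rep(1)[OF y]] unfolding rep(2)[OF x] rep(2)[OF y] .
  qed
qed

end

theorem theorem1p4:
  fixes r :: nat
    and P :: "real^'m^'m \<Rightarrow> real^'m^'m \<Rightarrow> real"
    and Q :: "real^('n::finite + 'n)^('n + 'n) \<Rightarrow> real^('n + 'n)^('n + 'n) \<Rightarrow> real"
  assumes "r > 1"
    and "CARD('m) = r + 1" and "CARD('n) = r"
    and "invariant_riemannian_metric SL SO P"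
    and "invariant_riemannian_metric Sp U Q"
  shows "\<exists>f. quasi_isometric_embedding
               (coset_space SL SO) (riemannian_dist SL P)
               (coset_space Sp U) (riemannian_dist Sp Q) f"
proof -
  obtain h :: "'m \<Rightarrow> nat" where "bij_betw h UNIV {0..<r + 1}"
    using ex_bij_betw_finite_nat[of "UNIV :: 'm set"] assms(2) by auto
  then have inj: "inj h" and range: "range h = {0..<r + 1}" by (auto simp: bij_betw_def)
  obtain p q where p: "h p = r" and q: "h q = 0"
    using range by (metis (no_types) add.commute atLeastLessThan_iff le0 less_add_one rangeE zero_less_Suc plus_1_eq_Suc)
  have "card (UNIV :: 'n set) = card (- {p} :: 'm set)"
    using assms(2,3) by (simp add: Compl_eq_Diff_UNIV card_Diff_singleton)
  then obtain \<iota> :: "'n \<Rightarrow> 'm" where "bij_betw \<iota> UNIV (- {p})"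
    using finite_same_card_bij[of "UNIV :: 'n set" "- {p}"] by auto
  then have \<iota>: "inj \<iota>" "range \<iota> = - {p}" by (auto simp: bij_betw_def)
  \<comment> \<open>By r > 1 the first and last index differ, so the first one survives the removal
    of \<open>p\<close> and can be \<open>\<iota> o'\<close>.\<close>
  have "q \<noteq> p" using p q assms(1) by auto
  then have "q \<in> range \<iota>" by (simp add: \<iota>)
  then obtain o' where o': "\<iota> o' = q" by blast
  interpret symplectic_embedding h \<iota> p o'
  proof
    fix i assume "i \<noteq> p"
    then have "h i \<noteq> r" using inj p by (auto dest: injD)
    moreover have "h i < r + 1" using range by auto
    ultimately show "h i < h p" by (simp add: p)
  next
    fix i assume "i \<noteq> \<iota> o'"
    then show "h (\<iota> o') < h i" using inj q o' by (metis gr0I injD)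
  qed (fact inj \<iota>)+
  show ?thesis by (rule coset_space_quasi_isometric_embedding[OF assms(4,5)])
qed

end
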